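(* The assignment $X\mapsto\mathrm{Inv}(X)$, $T\mapsto\mathrm{Inv}(T)$ is a contravariant functor from $\mathbf{Ban}$ to $\mathbf{Ban}$.
   Context: $\mathbf{Ban}$ is the category of (complex) Banach spaces with bounded linear operators as morphisms; $B(X,Y)$ denotes the bounded linear operators $X\to Y$. Tower system: $X_0:=X$, $X_{n+1}:=X_n^{**}$; $\kappa_{n,n+1}\colon X_n\to X_{n+1}$ is the canonical embedding into the bidual; for $n<m$, $\kappa_{n,m}:=\kappa_{m-1,m}\circ\cdots\circ\kappa_{n,n+1}$, and $\kappa_{n,n}=\mathrm{id}$. For $T\in B(X,Y)$: $\mathcal J_0(T):=T$, $\mathcal J_{n+1}(T):=\mathcal J_n(T)^{**}\in B(X_{n+1},Y_{n+1})$. Inverse limit: $\mathrm{Inv}(X)=\varprojlim X_n^*$ is the space of $\phi=(\phi_n)_{n\in\mathbb N}\in\prod_{n\ge0}X_n^*$ with $\phi_n=\kappa_{n,m}^*(\phi_m)$ for all $n\le m$ and $\|\phi\|:=\sup_n\|\phi_n\|<\infty$. $\mathrm{Inv}(T)\colon\mathrm{Inv}(Y)\to\mathrm{Inv}(X)$ is $(\phi_n)_n\mapsto(\mathcal J_n(T)^*(\phi_n))_n$. *)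

theory Defs
  imports Complex_Main "HOL-Algebra.Module" "HOL-Library.FuncSet" "HOL-Library.Countable"
begin

section \<open>The ambient set theory\<close>

text \<open>
  For a space such as \<open>X = \<ell>\<^sup>1\<close> the cardinalities of the iterated biduals \<open>X\<^sub>n\<close> are cofinal below
  beth-omega, and \<open>Inv(X)\<close>, which maps onto every \<open>X\<^sub>n\<^sup>*\<close>, has at least beth-omega elements. HOL
  does not provide a type of that size. Banach spaces are therefore taken inside an arbitrary model
  of ZFC: a type whose elements are the sets, with the axioms below. They are second-order:
  separation and replacement hold for all HOL sets and functions. Choice is that of HOL, and
  pairing is an instance of \<open>infinity\<close>.
\<close>

class zfc_model =
  fixes elts :: "'a \<Rightarrow> 'a set"
  assumes extensionality: "inj elts"
    and separation: "B \<subseteq> elts x \<Longrightarrow> B \<in> range elts"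
    and union: "\<Union> (elts ` elts x) \<in> range elts"
    and power_set: "{y. elts y \<subseteq> elts x} \<in> range elts"
    and replacement: "f ` elts x \<in> range elts"
    and infinity: "range (g :: nat \<Rightarrow> 'a) \<in> range elts"
    and foundation: "wf {(x, y). x \<in> elts y}"

definition small :: "'v::zfc_model set \<Rightarrow> bool"
  where "small A \<longleftrightarrow> A \<in> range elts"

definition vset :: "'v::zfc_model set \<Rightarrow> 'v"
  where "vset A = inv_into UNIV elts A"

definition vpair :: "'v::zfc_model \<Rightarrow> 'v \<Rightarrow> 'v"
  where "vpair x y = vset {vset {x}, vset {x, y}}"

definition vgraph :: "'v::zfc_model set \<Rightarrow> ('v \<Rightarrow> 'v) \<Rightarrow> 'v"
  where "vgraph A f = vset ((\<lambda>x. vpair x (f x)) ` A)"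

definition vapply :: "'v::zfc_model \<Rightarrow> 'v \<Rightarrow> 'v"
  where "vapply g x = (THE y. vpair x y \<in> elts g)"

text \<open>
  A copy of a HOL type inside the model. It is used only for \<open>nat\<close> and \<open>complex\<close>, where an
  injection exists (lemmas \<open>inj_vcopy_nat\<close> and \<open>inj_vcopy_complex\<close> below).
\<close>

definition vcopy :: "'b \<Rightarrow> 'v::zfc_model"
  where "vcopy = (SOME e. inj e)"

text \<open>Complex-valued functions on a set, and sequences, as elements of the model.\<close>

definition fun_code :: "'v::zfc_model set \<Rightarrow> ('v \<Rightarrow> complex) \<Rightarrow> 'v"
  where "fun_code A f = vgraph A (\<lambda>x. vcopy (f x))"

definition eval :: "'v::zfc_model \<Rightarrow> 'v \<Rightarrow> complex"
  where "eval \<phi> x = inv_into UNIV vcopy (vapply \<phi> x)"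

definition seq_code :: "(nat \<Rightarrow> 'v::zfc_model) \<Rightarrow> 'v"
  where "seq_code s = vgraph (range (vcopy :: nat \<Rightarrow> 'v)) (\<lambda>i. s (inv_into UNIV vcopy i))"

definition seq_nth :: "'v::zfc_model \<Rightarrow> nat \<Rightarrow> 'v"
  where "seq_nth \<phi> n = vapply \<phi> (vcopy n)"

lemma small_empty: "small {}"
  unfolding small_def by (rule separation[of _ undefined]) simp

lemma small_pair: "small {x, y :: 'v::zfc_model}"
proof -
  have "range (\<lambda>n::nat. if n = 0 then x else y) = {x, y}"
  proof (intro equalityI insert_subsetI empty_subsetI)
    show "x \<in> range (\<lambda>n::nat. if n = 0 then x else y)"
      by (rule range_eqI[of _ _ 0]) simp
    show "y \<in> range (\<lambda>n::nat. if n = 0 then x else y)"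
      by (rule range_eqI[of _ _ 1]) simp
  qed auto
  then show ?thesis
    unfolding small_def using infinity[of "\<lambda>n. if n = 0 then x else y"] by simp
qed

lemma small_image:
  fixes A :: "'v::zfc_model set" and f :: "'v \<Rightarrow> 'v"
  shows "small A \<Longrightarrow> small (f ` A)"
  unfolding small_def by (auto simp only: intro: replacement)

lemma elts_vset: "small A \<Longrightarrow> elts (vset A) = A"
  unfolding small_def vset_def by (rule f_inv_into_f)

lemma vset_inject: "small A \<Longrightarrow> small B \<Longrightarrow> vset A = vset B \<longleftrightarrow> A = B"
  by (metis elts_vset)

lemma vpair_inject: "vpair x y = vpair x' y' \<longleftrightarrow> x = x' \<and> y = (y' :: 'v::zfc_model)"
proof -
  have s: "small {a}" for a :: 'v
    using small_pair[of a a] by simp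
  show ?thesis
    unfolding vpair_def by (auto simp: vset_inject s small_pair doubleton_eq_iff)
qed

lemma vapply_vgraph:
  assumes "small A" "x \<in> A"
  shows "vapply (vgraph A f) x = f x"
proof -
  have "elts (vgraph A f) = (\<lambda>x. vpair x (f x)) ` A"
    unfolding vgraph_def by (intro elts_vset small_image assms)
  then show ?thesis
    unfolding vapply_def using assms(2) by (auto simp: vpair_inject)
qed

lemma ex_inj_nat: "\<exists>e :: nat \<Rightarrow> 'v::zfc_model. inj e"
proof -
  define e :: "nat \<Rightarrow> 'v" where "e = rec_nat (vset {}) (\<lambda>_ x. vset {x})"
  have s: "small {a}" for a :: 'v
    using small_pair[of a a] by simp
  have e: "e 0 = vset {}" "e (Suc n) = vset {e n}" for n
    unfolding e_def by simp_all
  have "e m = e n \<longrightarrow> m = n" for m n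
  proof (induction m arbitrary: n)
    case 0
    show ?case by (cases n) (auto simp: e vset_inject s small_empty)
  next
    case (Suc m)
    then show ?case by (cases n) (auto simp: e vset_inject s small_empty)
  qed
  then show ?thesis by (auto simp: inj_def)
qed

lemma inj_vcopy_nat: "inj (vcopy :: nat \<Rightarrow> 'v::zfc_model)"
  unfolding vcopy_def using ex_inj_nat by (rule someI_ex)

lemma inj_vcopy_complex: "inj (vcopy :: complex \<Rightarrow> 'v::zfc_model)"
proof -
  obtain e :: "nat \<Rightarrow> 'v" where e: "inj e"
    using ex_inj_nat by blast
  define S :: "complex \<Rightarrow> (bool \<times> rat) set"
    where "S z = {(b, q). of_rat q < (if b then Re z else Im z)}" for z
  define k :: "complex \<Rightarrow> 'v" where "k z = vset ((e \<circ> to_nat) ` S z)" for z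
  have cut: "a = b" if "\<And>q. of_rat q < a \<longleftrightarrow> of_rat q < b" for a b :: real
  proof (rule ccontr)
    assume "a \<noteq> b"
    then obtain q where "a < of_rat q \<and> of_rat q < b \<or> b < of_rat q \<and> of_rat q < a"
      using of_rat_dense[of a b] of_rat_dense[of b a] by (auto simp: neq_iff)
    then show False
      using that[of q] by auto
  qed
  have "inj S"
  proof (rule injI)
    fix z w assume "S z = S w"
    then have *: "(b, q) \<in> S z \<longleftrightarrow> (b, q) \<in> S w" for b q by simp
    show "z = w"
    proof (intro complex_eqI cut)
      show "of_rat q < Re z \<longleftrightarrow> of_rat q < Re w" for q
        using *[of True q] by (simp add: S_def)
      show "of_rat q < Im z \<longleftrightarrow> of_rat q < Im w" for q
        using *[of False q] by (simp add: S_def)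
    qed
  qed
  moreover have "small ((e \<circ> to_nat) ` A)" for A :: "(bool \<times> rat) set"
  proof -
    obtain r where "range e = elts r"
      using infinity[of e] by blast
    then show ?thesis
      unfolding small_def by (intro separation[of _ r]) auto
  qed
  moreover have "inj (e \<circ> (to_nat :: bool \<times> rat \<Rightarrow> nat))"
    using e by (intro inj_compose) auto
  ultimately have "inj k"
    unfolding k_def by (auto simp: inj_def vset_inject inj_image_eq_iff)
  then show ?thesis
    unfolding vcopy_def by (rule someI[of inj])
qed

lemma eval_fun_code:
  assumes "small A" "x \<in> A"
  shows "eval (fun_code A f) x = f x"
  by (simp add: eval_def fun_code_def vapply_vgraph[OF assms] inj_vcopy_complex)

lemma seq_nth_seq_code: "seq_nth (seq_code s) n = s n"
  by (simp add: seq_nth_def seq_code_def vapply_vgraph small_def infinity inj_vcopy_nat)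


section \<open>Banach spaces\<close>

text \<open>
  The fields \<open>mult\<close> and \<open>one\<close> that a module inherits from the ring record play no role.
\<close>

record 'v normed_space = "(complex, 'v) module" +
  vnorm :: "'v \<Rightarrow> real"

definition complex_ring :: "complex ring"
  where "complex_ring =
    \<lparr>carrier = UNIV, monoid.mult = (*), one = 1, ring.zero = 0, add = (+)\<rparr>"

locale normed_space = Module.module complex_ring X
  for X :: "'v normed_space" (structure) +
  assumes vnorm_nonneg: "x \<in> carrier X \<Longrightarrow> 0 \<le> vnorm X x"
    and vnorm_eq_0: "x \<in> carrier X \<Longrightarrow> vnorm X x = 0 \<longleftrightarrow> x = \<zero>"
    and vnorm_smult: "x \<in> carrier X \<Longrightarrow> vnorm X (c \<odot> x) = cmod c * vnorm X x"
    and vnorm_triangle: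
      "x \<in> carrier X \<Longrightarrow> y \<in> carrier X \<Longrightarrow> vnorm X (x \<oplus> y) \<le> vnorm X x + vnorm X y"

locale banach_space = normed_space +
  assumes complete:
    "\<lbrakk>range s \<subseteq> carrier X;
      \<forall>e>0. \<exists>N::nat. \<forall>m\<ge>N. \<forall>n\<ge>N. vnorm X (s m \<ominus> s n) < e\<rbrakk>
     \<Longrightarrow> \<exists>x\<in>carrier X. (\<lambda>n. vnorm X (s n \<ominus> x)) \<longlonglongrightarrow> 0"

definition bounded_ops :: "'v normed_space \<Rightarrow> 'v normed_space \<Rightarrow> ('v \<Rightarrow> 'v) set"
  where "bounded_ops X Y =
    {T \<in> carrier X \<rightarrow>\<^sub>E carrier Y.
      (\<forall>x\<in>carrier X. \<forall>y\<in>carrier X. T (x \<oplus>\<^bsub>X\<^esub> y) = T x \<oplus>\<^bsub>Y\<^esub> T y) \<and>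
      (\<forall>c. \<forall>x\<in>carrier X. T (c \<odot>\<^bsub>X\<^esub> x) = c \<odot>\<^bsub>Y\<^esub> T x) \<and>
      (\<exists>K. \<forall>x\<in>carrier X. vnorm Y (T x) \<le> K * vnorm X x)}"

definition bounded_functionals :: "'v normed_space \<Rightarrow> ('v \<Rightarrow> complex) set"
  where "bounded_functionals X =
    {f. (\<forall>x\<in>carrier X. \<forall>y\<in>carrier X. f (x \<oplus>\<^bsub>X\<^esub> y) = f x + f y) \<and>
        (\<forall>c. \<forall>x\<in>carrier X. f (c \<odot>\<^bsub>X\<^esub> x) = c * f x) \<and>
        (\<exists>K. \<forall>x\<in>carrier X. cmod (f x) \<le> K * vnorm X x)}"

definition dual :: "'v::zfc_model normed_space \<Rightarrow> 'v normed_space"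
  where "dual X =
    \<lparr>carrier = fun_code (carrier X) ` bounded_functionals X,
     monoid.mult = undefined, one = undefined,
     ring.zero = fun_code (carrier X) (\<lambda>x. 0),
     add = (\<lambda>\<phi> \<psi>. fun_code (carrier X) (\<lambda>x. eval \<phi> x + eval \<psi> x)),
     smult = (\<lambda>c \<phi>. fun_code (carrier X) (\<lambda>x. c * eval \<phi> x)),
     vnorm = (\<lambda>\<phi>. SUP x\<in>{x \<in> carrier X. vnorm X x \<le> 1}. cmod (eval \<phi> x))\<rparr>"

text \<open>\<open>adjoint X Y T\<close> is \<open>T\<^sup>* : Y\<^sup>* \<rightarrow> X\<^sup>*\<close> for \<open>T : X \<rightarrow> Y\<close>.\<close>

definition adjoint ::
    "'v::zfc_model normed_space \<Rightarrow> 'v normed_space \<Rightarrow> ('v \<Rightarrow> 'v) \<Rightarrow> 'v \<Rightarrow> 'v"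
  where "adjoint X Y T =
    (\<lambda>\<psi>\<in>carrier (dual Y). fun_code (carrier X) (\<lambda>x. eval \<psi> (T x)))"

abbreviation bidual :: "'v::zfc_model normed_space \<Rightarrow> 'v normed_space"
  where "bidual X \<equiv> dual (dual X)"

definition bidual_embedding :: "'v::zfc_model normed_space \<Rightarrow> 'v \<Rightarrow> 'v"
  where "bidual_embedding X =
    (\<lambda>x\<in>carrier X. fun_code (carrier (dual X)) (\<lambda>\<phi>. eval \<phi> x))"


section \<open>The bidual tower and its inverse limit\<close>

primrec tower :: "'v::zfc_model normed_space \<Rightarrow> nat \<Rightarrow> 'v normed_space"
  where
    "tower X 0 = X"
  | "tower X (Suc n) = bidual (tower X n)"

primrec tower_shift :: "'v::zfc_model normed_space \<Rightarrow> nat \<Rightarrow> nat \<Rightarrow> 'v \<Rightarrow> 'v"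
  where
    "tower_shift X n 0 = (\<lambda>x\<in>carrier (tower X n). x)"
  | "tower_shift X n (Suc d) =
      compose (carrier (tower X n)) (bidual_embedding (tower X (n + d))) (tower_shift X n d)"

text \<open>\<open>\<kappa>\<^sub>n\<^sub>,\<^sub>m : X\<^sub>n \<rightarrow> X\<^sub>m\<close>, meaningful for \<open>n \<le> m\<close>.\<close>

definition kappa :: "'v::zfc_model normed_space \<Rightarrow> nat \<Rightarrow> nat \<Rightarrow> 'v \<Rightarrow> 'v"
  where "kappa X n m = tower_shift X n (m - n)"

primrec tower_op ::
    "'v::zfc_model normed_space \<Rightarrow> 'v normed_space \<Rightarrow> ('v \<Rightarrow> 'v) \<Rightarrow> nat \<Rightarrow> 'v \<Rightarrow> 'v"
  where
    "tower_op X Y T 0 = T"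
  | "tower_op X Y T (Suc n) =
      adjoint (dual (tower Y n)) (dual (tower X n))
        (adjoint (tower X n) (tower Y n) (tower_op X Y T n))"

definition Inv_seqs :: "'v::zfc_model normed_space \<Rightarrow> (nat \<Rightarrow> 'v) set"
  where "Inv_seqs X =
    {\<phi>. (\<forall>n. \<phi> n \<in> carrier (dual (tower X n))) \<and>
        (\<forall>n m. n \<le> m \<longrightarrow> \<phi> n = adjoint (tower X n) (tower X m) (kappa X n m) (\<phi> m)) \<and>
        bdd_above (range (\<lambda>n. vnorm (dual (tower X n)) (\<phi> n)))}"

definition Inv :: "'v::zfc_model normed_space \<Rightarrow> 'v normed_space"
  where "Inv X =
    \<lparr>carrier = seq_code ` Inv_seqs X,
     monoid.mult = undefined, one = undefined,
     ring.zero = seq_code (\<lambda>n. \<zero>\<^bsub>dual (tower X n)\<^esub>),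
     add = (\<lambda>\<phi> \<psi>. seq_code (\<lambda>n. seq_nth \<phi> n \<oplus>\<^bsub>dual (tower X n)\<^esub> seq_nth \<psi> n)),
     smult = (\<lambda>c \<phi>. seq_code (\<lambda>n. c \<odot>\<^bsub>dual (tower X n)\<^esub> seq_nth \<phi> n)),
     vnorm = (\<lambda>\<phi>. SUP n. vnorm (dual (tower X n)) (seq_nth \<phi> n))\<rparr>"

definition Inv_map ::
    "'v::zfc_model normed_space \<Rightarrow> 'v normed_space \<Rightarrow> ('v \<Rightarrow> 'v) \<Rightarrow> 'v \<Rightarrow> 'v"
  where "Inv_map X Y T =
    (\<lambda>\<phi>\<in>carrier (Inv Y).
      seq_code (\<lambda>n. adjoint (tower X n) (tower Y n) (tower_op X Y T n) (seq_nth \<phi> n)))"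


section \<open>Categories and contravariant functors\<close>

text \<open>\<open>Comp C X Y Z g f\<close> is the composite \<open>g \<circ> f\<close> of \<open>f : X \<rightarrow> Y\<close> and \<open>g : Y \<rightarrow> Z\<close>.\<close>

record ('o, 'm) cat =
  Obj :: "'o set"
  Hom :: "'o \<Rightarrow> 'o \<Rightarrow> 'm set"
  Id :: "'o \<Rightarrow> 'm"
  Comp :: "'o \<Rightarrow> 'o \<Rightarrow> 'o \<Rightarrow> 'm \<Rightarrow> 'm \<Rightarrow> 'm"

locale category =
  fixes C :: "('o, 'm) cat"
  assumes Id_in_Hom: "X \<in> Obj C \<Longrightarrow> Id C X \<in> Hom C X X"
    and Comp_in_Hom:
      "\<lbrakk>X \<in> Obj C; Y \<in> Obj C; Z \<in> Obj C; f \<in> Hom C X Y; g \<in> Hom C Y Z\<rbrakk>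
       \<Longrightarrow> Comp C X Y Z g f \<in> Hom C X Z"
    and Comp_Id_right:
      "\<lbrakk>X \<in> Obj C; Y \<in> Obj C; f \<in> Hom C X Y\<rbrakk> \<Longrightarrow> Comp C X X Y f (Id C X) = f"
    and Comp_Id_left:
      "\<lbrakk>X \<in> Obj C; Y \<in> Obj C; f \<in> Hom C X Y\<rbrakk> \<Longrightarrow> Comp C X Y Y (Id C Y) f = f"
    and Comp_assoc:
      "\<lbrakk>W \<in> Obj C; X \<in> Obj C; Y \<in> Obj C; Z \<in> Obj C;
        f \<in> Hom C W X; g \<in> Hom C X Y; h \<in> Hom C Y Z\<rbrakk>
       \<Longrightarrow> Comp C W X Z (Comp C X Y Z h g) f = Comp C W Y Z h (Comp C W X Y g f)"

locale contravariant_functor = dom: category C + cod: category D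
  for C :: "('o, 'm) cat" and D :: "('p, 'n) cat" +
  fixes F_obj :: "'o \<Rightarrow> 'p"
    and F_map :: "'o \<Rightarrow> 'o \<Rightarrow> 'm \<Rightarrow> 'n"
  assumes F_obj: "X \<in> Obj C \<Longrightarrow> F_obj X \<in> Obj D"
    and F_map:
      "\<lbrakk>X \<in> Obj C; Y \<in> Obj C; f \<in> Hom C X Y\<rbrakk> \<Longrightarrow> F_map X Y f \<in> Hom D (F_obj Y) (F_obj X)"
    and F_Id: "X \<in> Obj C \<Longrightarrow> F_map X X (Id C X) = Id D (F_obj X)"
    and F_Comp:
      "\<lbrakk>X \<in> Obj C; Y \<in> Obj C; Z \<in> Obj C; f \<in> Hom C X Y; g \<in> Hom C Y Z\<rbrakk>
       \<Longrightarrow> F_map X Z (Comp C X Y Z g f)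
         = Comp D (F_obj Z) (F_obj Y) (F_obj X) (F_map X Y f) (F_map Y Z g)"

definition Ban :: "('v::zfc_model normed_space, 'v \<Rightarrow> 'v) cat"
  where "Ban =
    \<lparr>Obj = {X. banach_space X \<and> small (carrier X)},
     Hom = bounded_ops,
     Id = (\<lambda>X. \<lambda>x\<in>carrier X. x),
     Comp = (\<lambda>X Y Z g f. compose (carrier X) g f)\<rparr>"

end

theory Submission
  imports Defs
begin

text \<open>
  An adjoint satisfies every norm bound of the operator itself, so all \<open>\<J>\<^sub>n(T)\<close> share one bound
  of \<open>T\<close> and \<open>Inv(T)\<close> is bounded by it; the Hahn-Banach theorem is not needed. Compatible families
  are mapped to compatible families because the embeddings \<open>X \<rightarrow> X\<^sup>*\<^sup>*\<close> are natural in \<open>X\<close>.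
  \<open>Inv(X)\<close> is complete since a Cauchy sequence converges in every component, uniformly in the
  index, and compatibility is a pointwise condition on functionals, preserved by pointwise limits.
\<close>

section \<open>Small sets\<close>

text \<open>The objects of \<open>Ban\<close> live inside a model of set theory, and this shapes the
  proof. Duals and inverse limits consist of coded functions, and a code is known to evaluate
  correctly only over a \<open>small\<close> domain. Smallness of each carrier is therefore carried
  along with the norm estimates, through every dual and through the countable product that contains
  \<open>Inv X\<close>. The bound for duals rests on a small copy of the complex numbers, found
  inside a power set.

  Equalities between coded objects are reduced twice: \<open>Inv_ext\<close> compares components,
  \<open>dual_ext\<close> compares values. Vector space axioms, naturality and the functor laws thus
  become identities between complex numbers. Operators are \<open>undefined\<close> off their
  carrier, so the functor laws can hold as equalities of HOL functions. Compatibility is used in the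
  form \<open>Inv_seqs_iff\<close>, indexed by a level n and a height d: inductions run over d, and
  the truncated subtraction in \<open>kappa\<close> disappears.\<close>

lemma small_subset: "B \<subseteq> A \<Longrightarrow> small A \<Longrightarrow> small B"
  unfolding small_def using separation by blast

text \<open>The union axiom speaks of elements of the model, not of HOL sets: replacement collects
  the codes \<open>vset (F x)\<close> into one set, whose elements decode to the
  \<open>F x\<close>.\<close>

lemma small_Union:
  fixes A :: "'v::zfc_model set" and F :: "'v \<Rightarrow> 'v set"
  assumes "small A" and "\<And>x. x \<in> A \<Longrightarrow> small (F x)"
  shows "small (\<Union>x\<in>A. F x)"
proof -
  obtain a where a: "elts a = (\<lambda>x. vset (F x)) ` A"
    using small_image[OF assms(1), of "\<lambda>x. vset (F x)"] unfolding small_def by force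
  have "\<Union> (elts ` elts a) = (\<Union>x\<in>A. F x)"
    unfolding a using assms(2) by (simp add: elts_vset)
  then show ?thesis
    using union[of a] by (simp add: small_def)
qed

lemma small_range_nat: "small (range (g :: nat \<Rightarrow> 'v::zfc_model))"
  unfolding small_def by (rule infinity)

text \<open>\<open>small_Union\<close> wants indices in the model, so the natural numbers are
  replaced by their copy under \<open>vcopy\<close>.\<close>

lemma small_UN_nat:
  fixes F :: "nat \<Rightarrow> 'v::zfc_model set"
  assumes "\<And>n. small (F n)"
  shows "small (\<Union>n. F n)"
proof -
  have "(\<Union>n. F n) = (\<Union>x\<in>range (vcopy :: nat \<Rightarrow> 'v). F (inv_into UNIV vcopy x))"
    by (simp add: inj_vcopy_nat)
  then show ?thesis
    using small_Union[OF small_range_nat] assms by metis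
qed

lemma small_Pow:
  assumes "small (A :: 'v::zfc_model set)"
  shows "small {y. elts y \<subseteq> A}"
  using assms power_set unfolding small_def by blast

lemma small_range_complex: "small (range (vcopy :: complex \<Rightarrow> 'v::zfc_model))"
proof -
  \<comment> \<open>Pairs of Dedekind cuts embed \<open>complex\<close> into the power set of a countable set of the model.\<close>
  define e :: "bool \<times> rat \<Rightarrow> 'v" where "e = vcopy \<circ> to_nat"
  define S :: "complex \<Rightarrow> (bool \<times> rat) set"
    where "S z = {(b, q). of_rat q < (if b then Re z else Im z)}" for z
  define k :: "complex \<Rightarrow> 'v" where "k z = vset (e ` S z)" for z
  have "inj e"
    unfolding e_def by (intro inj_compose inj_vcopy_nat) auto
  have small_e: "small (e ` A)" for A
    by (rule small_subset[OF _ small_range_nat[of vcopy]]) (auto simp: e_def)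
  have cut: "a = b" if "\<And>q. of_rat q < a \<longleftrightarrow> of_rat q < b" for a b :: real
  proof (rule ccontr)
    assume "a \<noteq> b"
    then obtain q where "a < of_rat q \<and> of_rat q < b \<or> b < of_rat q \<and> of_rat q < a"
      using of_rat_dense[of a b] of_rat_dense[of b a] by (auto simp: neq_iff)
    then show False
      using that[of q] by auto
  qed
  have "inj S"
  proof (rule injI)
    fix z w assume "S z = S w"
    then have *: "(b, q) \<in> S z \<longleftrightarrow> (b, q) \<in> S w" for b q by simp
    show "z = w"
    proof (intro complex_eqI cut)
      show "of_rat q < Re z \<longleftrightarrow> of_rat q < Re w" for q
        using *[of True q] by (simp add: S_def)
      show "of_rat q < Im z \<longleftrightarrow> of_rat q < Im w" for q
        using *[of False q] by (simp add: S_def)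
    qed
  qed
  with \<open>inj e\<close> have "inj k"
    unfolding k_def by (auto simp: inj_def vset_inject small_e inj_image_eq_iff)
  have "range k \<subseteq> {y. elts y \<subseteq> range e}"
    by (auto simp: k_def elts_vset small_e)
  then have "small (range k)"
    using small_subset small_Pow small_e by blast
  \<comment> \<open>\<open>vcopy\<close> is an arbitrary injection, so its range is reached from
    that of \<open>k\<close> by replacement along the inverse of \<open>k\<close>.\<close>
  then have "small ((\<lambda>x. vcopy (inv_into UNIV k x) :: 'v) ` range k)"
    by (rule small_image)
  then show ?thesis
    using \<open>inj k\<close> by (simp add: image_image)
qed

text \<open>Every such graph is a subset of the product of \<open>A\<close> and \<open>B\<close>,
  here a union of small slices, and hence lies in a power set.\<close>

lemma small_vgraphs:
  fixes A B :: "'v::zfc_model set"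
  assumes "small A" "small B"
  shows "small (vgraph A ` (A \<rightarrow> B))"
proof -
  have "small (\<Union>x\<in>A. vpair x ` B)"
    by (intro small_Union small_image assms)
  moreover have "elts (vgraph A f) \<subseteq> (\<Union>x\<in>A. vpair x ` B)" if "f \<in> A \<rightarrow> B" for f
    unfolding vgraph_def elts_vset[OF small_image[OF assms(1)]] using that by blast
  ultimately show ?thesis
    by (intro small_subset[OF image_subsetI small_Pow]) auto
qed

text \<open>The coded values of all complex-valued functions lie in the single small set
  \<open>range vcopy\<close>. This bounds the carrier of every dual.\<close>

lemma small_fun_codes:
  assumes "small A"
  shows "small (range (fun_code A))"
  by (rule small_subset[OF _ small_vgraphs[OF assms small_range_complex]])
    (auto simp: fun_code_def)

lemma small_seq_codes:
  fixes F :: "nat \<Rightarrow> 'v::zfc_model set"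
  assumes "\<And>n. small (F n)"
  shows "small (seq_code ` {s. \<forall>n. s n \<in> F n})"
  by (rule small_subset[OF _ small_vgraphs[OF small_range_nat[of vcopy] small_UN_nat[of F, OF assms]]])
    (auto simp: seq_code_def inj_vcopy_nat intro!: imageI)

lemma fun_code_cong: "(\<And>x. x \<in> A \<Longrightarrow> f x = g x) \<Longrightarrow> fun_code A f = fun_code A g"
  unfolding fun_code_def vgraph_def by (metis (mono_tags, lifting) image_cong)

section \<open>Normed spaces\<close>

lemma complex_ring_simps [simp]:
  "carrier complex_ring = UNIV" "a \<otimes>\<^bsub>complex_ring\<^esub> b = a * b" "\<one>\<^bsub>complex_ring\<^esub> = 1"
  "\<zero>\<^bsub>complex_ring\<^esub> = 0" "a \<oplus>\<^bsub>complex_ring\<^esub> b = a + b"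
  by (simp_all add: complex_ring_def)

lemma cring_complex_ring: "cring complex_ring"
proof (rule cringI)
  show "abelian_group complex_ring"
    by (rule abelian_groupI) (auto simp: add.assoc add.commute intro: exI[of _ "- _"])
  show "comm_monoid complex_ring"
    by (rule comm_monoidI) auto
qed (auto simp: algebra_simps)

text \<open>An introduction rule suited to componentwise operations. Negatives arise as
  \<open>(-1) \<odot> x\<close>, because \<open>(-1 + 1) \<odot> x\<close> is zero. Equality in the
  homogeneity of the norm follows from the inequality used for c and for its inverse.\<close>

lemma normed_spaceI:
  fixes X :: "'v normed_space" (structure)
  assumes closed: "\<And>x y. x \<in> carrier X \<Longrightarrow> y \<in> carrier X \<Longrightarrow> x \<oplus> y \<in> carrier X"
      "\<zero> \<in> carrier X" "\<And>c x. x \<in> carrier X \<Longrightarrow> c \<odot> x \<in> carrier X"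
    and assoc: "\<And>x y z. x \<in> carrier X \<Longrightarrow> y \<in> carrier X \<Longrightarrow> z \<in> carrier X \<Longrightarrow>
      (x \<oplus> y) \<oplus> z = x \<oplus> (y \<oplus> z)"
    and comm: "\<And>x y. x \<in> carrier X \<Longrightarrow> y \<in> carrier X \<Longrightarrow> x \<oplus> y = y \<oplus> x"
    and zero: "\<And>x. x \<in> carrier X \<Longrightarrow> \<zero> \<oplus> x = x"
    and smult_add_left: "\<And>a b x. x \<in> carrier X \<Longrightarrow> (a + b) \<odot> x = a \<odot> x \<oplus> b \<odot> x"
    and smult_add_right: "\<And>c x y. x \<in> carrier X \<Longrightarrow> y \<in> carrier X \<Longrightarrow>
      c \<odot> (x \<oplus> y) = c \<odot> x \<oplus> c \<odot> y"
    and smult_mult: "\<And>a b x. x \<in> carrier X \<Longrightarrow> (a * b) \<odot> x = a \<odot> (b \<odot> x)"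
    and smult_one: "\<And>x. x \<in> carrier X \<Longrightarrow> 1 \<odot> x = x"
    and smult_zero: "\<And>x. x \<in> carrier X \<Longrightarrow> 0 \<odot> x = \<zero>"
    and norm_nonneg: "\<And>x. x \<in> carrier X \<Longrightarrow> 0 \<le> vnorm X x"
    and norm_eq_zero: "\<And>x. x \<in> carrier X \<Longrightarrow> vnorm X x = 0 \<Longrightarrow> x = \<zero>"
    and norm_smult_le: "\<And>c x. x \<in> carrier X \<Longrightarrow> vnorm X (c \<odot> x) \<le> cmod c * vnorm X x"
    and norm_triangle: "\<And>x y. x \<in> carrier X \<Longrightarrow> y \<in> carrier X \<Longrightarrow>
      vnorm X (x \<oplus> y) \<le> vnorm X x + vnorm X y"
  shows "normed_space X"
proof -
  have "(-1) \<odot> x \<oplus> x = \<zero>" if "x \<in> carrier X" for x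
    using smult_add_left[OF that, of "-1" 1] that by (simp add: smult_one smult_zero)
  then have group: "abelian_group X"
    by (intro abelian_groupI closed assoc comm zero) (use closed in blast)+
  have norm_smult: "vnorm X (c \<odot> x) = cmod c * vnorm X x" if x: "x \<in> carrier X" for c x
  proof (cases "c = 0")
    case True
    then show ?thesis
      using norm_smult_le[OF x, of 0] norm_nonneg[OF closed(3)[OF x, of 0]] by simp
  next
    case False
    have "vnorm X x = vnorm X (inverse c \<odot> (c \<odot> x))"
      using False x by (simp add: smult_mult[symmetric] smult_one)
    also have "\<dots> \<le> inverse (cmod c) * vnorm X (c \<odot> x)"
      using norm_smult_le[OF closed(3)[OF x], of "inverse c" c] by (simp add: norm_inverse)
    finally have "cmod c * vnorm X x \<le> vnorm X (c \<odot> x)"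
      using False by (simp add: field_simps)
    with norm_smult_le[OF x, of c] show ?thesis by simp
  qed
  show ?thesis
  proof (intro normed_space.intro normed_space_axioms.intro module.intro module_axioms.intro
      cring_complex_ring group)
    show "vnorm X x = 0 \<longleftrightarrow> x = \<zero>" if "x \<in> carrier X" for x
      using norm_eq_zero[OF that] norm_smult[OF that, of 0] smult_zero[OF that] by auto
  qed (simp_all add: closed smult_add_left smult_add_right smult_mult smult_one norm_nonneg
      norm_smult norm_triangle)
qed

context normed_space
begin

lemma smult_closed' [simp]: "x \<in> carrier X \<Longrightarrow> c \<odot> x \<in> carrier X"
  using smult_closed by simp

lemma smult_add: "x \<in> carrier X \<Longrightarrow> (a + b) \<odot> x = a \<odot> x \<oplus> b \<odot> x"
  using smult_l_distr[of a b x] by simp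

lemma smult_add_distrib:
  "x \<in> carrier X \<Longrightarrow> y \<in> carrier X \<Longrightarrow> c \<odot> (x \<oplus> y) = c \<odot> x \<oplus> c \<odot> y"
  using smult_r_distr[of c x y] by simp

lemma smult_mult: "x \<in> carrier X \<Longrightarrow> (a * b) \<odot> x = a \<odot> (b \<odot> x)"
  using smult_assoc1[of a b x] by simp

lemma smult_one' [simp]: "x \<in> carrier X \<Longrightarrow> 1 \<odot> x = x"
  using smult_one[of x] by simp

lemma smult_zero_left [simp]: "x \<in> carrier X \<Longrightarrow> 0 \<odot> x = \<zero>"
  using smult_l_null[of x] by simp

text \<open>Completeness is stated with differences, whereas the records \<open>dual\<close> and
  \<open>Inv\<close> specify only sums and scalar multiples; this passes from one to the
  other.\<close>

lemma minus_eq_smult: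
  assumes "x \<in> carrier X" "y \<in> carrier X"
  shows "x \<ominus> y = x \<oplus> (-1) \<odot> y"
proof -
  have "\<ominus> y = (-1) \<odot> y"
    using smult_add[OF assms(2), of "-1" 1] assms(2) by (intro minus_equality) simp_all
  then show ?thesis
    by (simp add: a_minus_def)
qed

end

lemma bounded_opsI:
  assumes "T \<in> carrier X \<rightarrow>\<^sub>E carrier Y"
    and "\<And>x y. x \<in> carrier X \<Longrightarrow> y \<in> carrier X \<Longrightarrow> T (x \<oplus>\<^bsub>X\<^esub> y) = T x \<oplus>\<^bsub>Y\<^esub> T y"
    and "\<And>c x. x \<in> carrier X \<Longrightarrow> T (c \<odot>\<^bsub>X\<^esub> x) = c \<odot>\<^bsub>Y\<^esub> T x"
    and "\<And>x. x \<in> carrier X \<Longrightarrow> vnorm Y (T x) \<le> K * vnorm X x"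
  shows "T \<in> bounded_ops X Y"
  using assms unfolding bounded_ops_def by blast

lemma bounded_opsD:
  assumes "T \<in> bounded_ops X Y"
  shows "T \<in> carrier X \<rightarrow>\<^sub>E carrier Y" "T \<in> extensional (carrier X)"
    and "x \<in> carrier X \<Longrightarrow> T x \<in> carrier Y"
    and "x \<in> carrier X \<Longrightarrow> y \<in> carrier X \<Longrightarrow> T (x \<oplus>\<^bsub>X\<^esub> y) = T x \<oplus>\<^bsub>Y\<^esub> T y"
    and "x \<in> carrier X \<Longrightarrow> T (c \<odot>\<^bsub>X\<^esub> x) = c \<odot>\<^bsub>Y\<^esub> T x"
  using assms unfolding bounded_ops_def PiE_def by auto

text \<open>Passing to the absolute value makes the constant nonnegative, as the monotonicity of
  products in later estimates demands.\<close>

lemma (in normed_space) bounded_ops_bound: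
  assumes "T \<in> bounded_ops X Y"
  obtains K where "0 \<le> K" "\<And>x. x \<in> carrier X \<Longrightarrow> vnorm Y (T x) \<le> K * vnorm X x"
proof -
  obtain K where "\<forall>x\<in>carrier X. vnorm Y (T x) \<le> K * vnorm X x"
    using assms unfolding bounded_ops_def by blast
  then have "vnorm Y (T x) \<le> \<bar>K\<bar> * vnorm X x" if "x \<in> carrier X" for x
    using that vnorm_nonneg[OF that] by (meson abs_ge_self mult_right_mono order_trans)
  then show thesis
    using that[of "\<bar>K\<bar>"] by simp
qed

lemma (in normed_space) id_bounded_ops: "(\<lambda>x\<in>carrier X. x) \<in> bounded_ops X X"
  by (rule bounded_opsI[where K = 1]) auto

lemma compose_bounded_ops:
  assumes "normed_space X" "normed_space Y" "S \<in> bounded_ops X Y" "T \<in> bounded_ops Y Z"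
  shows "compose (carrier X) T S \<in> bounded_ops X Z"
proof -
  interpret X: normed_space X by fact
  interpret Y: normed_space Y by fact
  obtain K where K: "0 \<le> K" "\<And>x. x \<in> carrier X \<Longrightarrow> vnorm Y (S x) \<le> K * vnorm X x"
    using X.bounded_ops_bound[OF assms(3)] by blast
  obtain L where L: "0 \<le> L" "\<And>y. y \<in> carrier Y \<Longrightarrow> vnorm Z (T y) \<le> L * vnorm Y y"
    using Y.bounded_ops_bound[OF assms(4)] by blast
  note S = bounded_opsD[OF assms(3)] and T = bounded_opsD[OF assms(4)]
  show ?thesis
  proof (rule bounded_opsI[where K = "L * K"])
    fix x assume x: "x \<in> carrier X"
    have "vnorm Z (T (S x)) \<le> L * vnorm Y (S x)"
      using x by (intro L S)
    also have "\<dots> \<le> L * (K * vnorm X x)"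
      using x by (intro mult_left_mono K L)
    finally show "vnorm Z (compose (carrier X) T S x) \<le> L * K * vnorm X x"
      using x by (simp add: compose_eq mult.assoc)
  qed (use S T in \<open>auto simp: compose_eq intro!: PiE_I simp: compose_def\<close>)
qed

section \<open>Dual spaces\<close>

text \<open>Smallness of the carrier is what makes \<open>eval\<close> invert
  \<open>fun_code\<close> on it, so that coded functionals behave like functions.\<close>

locale small_normed_space = normed_space X
  for X :: "'v::zfc_model normed_space" (structure) +
  assumes small_carrier: "small (carrier X)"
begin

lemma dual_simps:
  "carrier (dual X) = fun_code (carrier X) ` bounded_functionals X"
  "\<zero>\<^bsub>dual X\<^esub> = fun_code (carrier X) (\<lambda>x. 0)"
  "\<phi> \<oplus>\<^bsub>dual X\<^esub> \<psi> = fun_code (carrier X) (\<lambda>x. eval \<phi> x + eval \<psi> x)"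
  "c \<odot>\<^bsub>dual X\<^esub> \<phi> = fun_code (carrier X) (\<lambda>x. c * eval \<phi> x)"
  "vnorm (dual X) \<phi> = (SUP x\<in>{x \<in> carrier X. vnorm X x \<le> 1}. cmod (eval \<phi> x))"
  by (simp_all add: dual_def)

lemma eval_code [simp]: "x \<in> carrier X \<Longrightarrow> eval (fun_code (carrier X) f) x = f x"
  by (rule eval_fun_code[OF small_carrier])

lemma eval_dual_ops [simp]:
  assumes "x \<in> carrier X"
  shows "eval \<zero>\<^bsub>dual X\<^esub> x = 0" "eval (\<phi> \<oplus>\<^bsub>dual X\<^esub> \<psi>) x = eval \<phi> x + eval \<psi> x"
    "eval (c \<odot>\<^bsub>dual X\<^esub> \<phi>) x = c * eval \<phi> x"
  using assms by (simp_all add: dual_simps)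

lemma code_in_dualI:
  assumes "\<And>x y. x \<in> carrier X \<Longrightarrow> y \<in> carrier X \<Longrightarrow> f (x \<oplus> y) = f x + f y"
    and "\<And>c x. x \<in> carrier X \<Longrightarrow> f (c \<odot> x) = c * f x"
    and "\<And>x. x \<in> carrier X \<Longrightarrow> cmod (f x) \<le> K * vnorm X x"
  shows "fun_code (carrier X) f \<in> carrier (dual X)"
  using assms unfolding dual_simps bounded_functionals_def by blast

text \<open>Both functionals are codes over the same carrier, and a code depends only on the values
  there.\<close>

lemma dual_ext:
  assumes "\<phi> \<in> carrier (dual X)" "\<psi> \<in> carrier (dual X)"
    and "\<And>x. x \<in> carrier X \<Longrightarrow> eval \<phi> x = eval \<psi> x"
  shows "\<phi> = \<psi>"
  using assms by (auto simp: dual_simps intro!: fun_code_cong)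

lemma
  assumes "\<phi> \<in> carrier (dual X)"
  shows eval_add: "x \<in> carrier X \<Longrightarrow> y \<in> carrier X \<Longrightarrow> eval \<phi> (x \<oplus> y) = eval \<phi> x + eval \<phi> y"
    and eval_smult: "x \<in> carrier X \<Longrightarrow> eval \<phi> (c \<odot> x) = c * eval \<phi> x"
    and eval_bounded: "\<exists>K\<ge>0. \<forall>x\<in>carrier X. cmod (eval \<phi> x) \<le> K * vnorm X x"
proof -
  obtain f where f: "\<phi> = fun_code (carrier X) f" "f \<in> bounded_functionals X"
    using assms by (auto simp: dual_simps)
  then show "x \<in> carrier X \<Longrightarrow> y \<in> carrier X \<Longrightarrow> eval \<phi> (x \<oplus> y) = eval \<phi> x + eval \<phi> y"
    and "x \<in> carrier X \<Longrightarrow> eval \<phi> (c \<odot> x) = c * eval \<phi> x"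
    by (simp_all add: bounded_functionals_def)
  obtain K where "\<forall>x\<in>carrier X. cmod (f x) \<le> K * vnorm X x"
    using f by (auto simp: bounded_functionals_def)
  then have "cmod (eval \<phi> x) \<le> \<bar>K\<bar> * vnorm X x" if "x \<in> carrier X" for x
    using that vnorm_nonneg[OF that] f(1)
    by (metis abs_ge_self eval_code mult_right_mono order_trans)
  then show "\<exists>K\<ge>0. \<forall>x\<in>carrier X. cmod (eval \<phi> x) \<le> K * vnorm X x"
    using abs_ge_zero by blast
qed

lemma unit_ball_nonempty: "{x \<in> carrier X. vnorm X x \<le> 1} \<noteq> {}"
  using vnorm_eq_0[of \<zero>] by (auto intro!: exI[of _ \<zero>])

lemma dual_norm_le:
  assumes "0 \<le> K" "\<And>x. x \<in> carrier X \<Longrightarrow> cmod (eval \<phi> x) \<le> K * vnorm X x"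
  shows "vnorm (dual X) \<phi> \<le> K"
  unfolding dual_simps
proof (rule cSUP_least[OF unit_ball_nonempty])
  fix x assume "x \<in> {x \<in> carrier X. vnorm X x \<le> 1}"
  then show "cmod (eval \<phi> x) \<le> K"
    using assms(2)[of x] mult_left_mono[OF _ assms(1), of "vnorm X x" 1] by simp
qed

text \<open>Boundedness of the functional makes the set of values on the unit ball bounded above, so
  that the real supremum in the norm is a genuine upper bound.\<close>

lemma eval_unit_le:
  assumes "\<phi> \<in> carrier (dual X)" "x \<in> carrier X" "vnorm X x \<le> 1"
  shows "cmod (eval \<phi> x) \<le> vnorm (dual X) \<phi>"
proof -
  obtain K where K: "0 \<le> K" "\<forall>x\<in>carrier X. cmod (eval \<phi> x) \<le> K * vnorm X x"
    using eval_bounded[OF assms(1)] by blast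
  have "cmod (eval \<phi> y) \<le> K" if "y \<in> carrier X" "vnorm X y \<le> 1" for y
    using K that mult_left_mono[OF that(2) K(1)] by fastforce
  then show ?thesis
    unfolding dual_simps using assms by (intro cSUP_upper bdd_aboveI2) auto
qed

text \<open>Scaling by the inverse norm moves a vector into the unit ball. For a vector of norm
  zero, any bound of the functional already forces the value zero.\<close>

lemma eval_le:
  assumes "\<phi> \<in> carrier (dual X)" "x \<in> carrier X"
  shows "cmod (eval \<phi> x) \<le> vnorm (dual X) \<phi> * vnorm X x"
proof (cases "vnorm X x = 0")
  case True
  then show ?thesis
    using eval_bounded[OF assms(1)] assms(2) by fastforce
next
  case False
  then have pos: "0 < vnorm X x"
    using vnorm_nonneg[OF assms(2)] by simp
  define c where "c = complex_of_real (inverse (vnorm X x))"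
  have "vnorm X (c \<odot> x) \<le> 1"
    using pos assms(2) by (simp add: vnorm_smult c_def norm_inverse)
  then have "cmod (eval \<phi> (c \<odot> x)) \<le> vnorm (dual X) \<phi>"
    using assms by (intro eval_unit_le) auto
  then show ?thesis
    using pos assms by (simp add: eval_smult c_def norm_mult norm_divide field_simps)
qed

lemma dual_norm_nonneg:
  assumes "\<phi> \<in> carrier (dual X)"
  shows "0 \<le> vnorm (dual X) \<phi>"
proof -
  have "0 \<le> cmod (eval \<phi> \<zero>)"
    by simp
  also have "\<dots> \<le> vnorm (dual X) \<phi>"
    using vnorm_eq_0[of \<zero>] by (intro eval_unit_le assms) simp_all
  finally show ?thesis .
qed

lemma dual_closed:
  shows dual_zero_closed: "\<zero>\<^bsub>dual X\<^esub> \<in> carrier (dual X)"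
    and dual_add_closed: "\<phi> \<in> carrier (dual X) \<Longrightarrow> \<psi> \<in> carrier (dual X) \<Longrightarrow>
      \<phi> \<oplus>\<^bsub>dual X\<^esub> \<psi> \<in> carrier (dual X)"
    and dual_smult_closed: "\<phi> \<in> carrier (dual X) \<Longrightarrow> c \<odot>\<^bsub>dual X\<^esub> \<phi> \<in> carrier (dual X)"
proof -
  show "\<zero>\<^bsub>dual X\<^esub> \<in> carrier (dual X)"
    unfolding dual_simps(2) by (rule code_in_dualI[where K = 0]) auto
next
  assume \<phi>: "\<phi> \<in> carrier (dual X)" and \<psi>: "\<psi> \<in> carrier (dual X)"
  show "\<phi> \<oplus>\<^bsub>dual X\<^esub> \<psi> \<in> carrier (dual X)"
    unfolding dual_simps(3)
  proof (rule code_in_dualI[where K = "vnorm (dual X) \<phi> + vnorm (dual X) \<psi>"])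
    fix x assume x: "x \<in> carrier X"
    show "cmod (eval \<phi> x + eval \<psi> x) \<le> (vnorm (dual X) \<phi> + vnorm (dual X) \<psi>) * vnorm X x"
      using eval_le[OF \<phi> x] eval_le[OF \<psi> x] norm_triangle_ineq[of "eval \<phi> x" "eval \<psi> x"]
      by (simp add: algebra_simps)
  qed (simp_all add: eval_add[OF \<phi>] eval_add[OF \<psi>] eval_smult[OF \<phi>] eval_smult[OF \<psi>]
      algebra_simps)
next
  assume \<phi>: "\<phi> \<in> carrier (dual X)"
  show "c \<odot>\<^bsub>dual X\<^esub> \<phi> \<in> carrier (dual X)"
    unfolding dual_simps(4)
  proof (rule code_in_dualI[where K = "cmod c * vnorm (dual X) \<phi>"])
    fix x assume x: "x \<in> carrier X"
    show "cmod (c * eval \<phi> x) \<le> cmod c * vnorm (dual X) \<phi> * vnorm X x"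
      using mult_left_mono[OF eval_le[OF \<phi> x], of "cmod c"]
      by (simp add: norm_mult mult.assoc)
  qed (simp_all add: eval_add[OF \<phi>] eval_smult[OF \<phi>] algebra_simps)
qed

lemma normed_space_dual: "normed_space (dual X)"
proof (rule normed_spaceI)
  fix \<phi> assume \<phi>: "\<phi> \<in> carrier (dual X)" and "vnorm (dual X) \<phi> = 0"
  then have "eval \<phi> x = 0" if "x \<in> carrier X" for x
    using eval_le[OF \<phi> that] by simp
  then show "\<phi> = \<zero>\<^bsub>dual X\<^esub>"
    by (intro dual_ext dual_closed \<phi>) simp
next
  fix c \<phi> assume \<phi>: "\<phi> \<in> carrier (dual X)"
  show "vnorm (dual X) (c \<odot>\<^bsub>dual X\<^esub> \<phi>) \<le> cmod c * vnorm (dual X) \<phi>"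
  proof (rule dual_norm_le)
    fix x assume x: "x \<in> carrier X"
    show "cmod (eval (c \<odot>\<^bsub>dual X\<^esub> \<phi>) x) \<le> cmod c * vnorm (dual X) \<phi> * vnorm X x"
      using mult_left_mono[OF eval_le[OF \<phi> x], of "cmod c"] x
      by (simp add: norm_mult mult.assoc)
  qed (simp add: dual_norm_nonneg[OF \<phi>])
next
  fix \<phi> \<psi> assume \<phi>: "\<phi> \<in> carrier (dual X)" and \<psi>: "\<psi> \<in> carrier (dual X)"
  show "vnorm (dual X) (\<phi> \<oplus>\<^bsub>dual X\<^esub> \<psi>) \<le> vnorm (dual X) \<phi> + vnorm (dual X) \<psi>"
  proof (rule dual_norm_le)
    fix x assume x: "x \<in> carrier X"
    show "cmod (eval (\<phi> \<oplus>\<^bsub>dual X\<^esub> \<psi>) x) \<le> (vnorm (dual X) \<phi> + vnorm (dual X) \<psi>) * vnorm X x"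
      using eval_le[OF \<phi> x] eval_le[OF \<psi> x] norm_triangle_ineq[of "eval \<phi> x" "eval \<psi> x"] x
      by (simp add: algebra_simps)
  qed (simp add: dual_norm_nonneg \<phi> \<psi>)
qed (auto intro!: dual_ext dual_closed dual_norm_nonneg simp: algebra_simps)

lemma small_normed_space_dual: "small_normed_space (dual X)"
proof (intro small_normed_space.intro small_normed_space_axioms.intro normed_space_dual)
  show "small (carrier (dual X))"
    by (rule small_subset[OF _ small_fun_codes[OF small_carrier]]) (auto simp: dual_simps)
qed

lemma eval_minus:
  assumes "\<phi> \<in> carrier (dual X)" "\<psi> \<in> carrier (dual X)" "x \<in> carrier X"
  shows "eval (\<phi> \<ominus>\<^bsub>dual X\<^esub> \<psi>) x = eval \<phi> x - eval \<psi> x"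
  using assms by (simp add: normed_space.minus_eq_smult[OF normed_space_dual])

text \<open>The limit is the pointwise limit \<open>f\<close> of the functionals; completeness of
  the complex numbers supplies it, and the Cauchy condition makes the convergence uniform relative
  to the norm of x.\<close>

lemma banach_space_dual: "banach_space (dual X)"
proof (intro banach_space.intro banach_space_axioms.intro normed_space_dual)
  interpret D: normed_space "dual X" by (rule normed_space_dual)
  fix s :: "nat \<Rightarrow> 'v"
  assume "range s \<subseteq> carrier (dual X)"
    and cauchy: "\<forall>e>0. \<exists>N. \<forall>m\<ge>N. \<forall>n\<ge>N. vnorm (dual X) (s m \<ominus>\<^bsub>dual X\<^esub> s n) < e"
  then have s: "s n \<in> carrier (dual X)" for n by auto
  have diff: "cmod (eval (s m) x - eval (s n) x) \<le> e * vnorm X x"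
    if "vnorm (dual X) (s m \<ominus>\<^bsub>dual X\<^esub> s n) < e" "x \<in> carrier X" for m n x e
    using eval_le[OF D.minus_closed[OF s s] that(2), of m n] that
      mult_right_mono[OF less_imp_le[OF that(1)] vnorm_nonneg[OF that(2)]]
    by (simp add: eval_minus s)
  have "convergent (\<lambda>n. eval (s n) x)" if x: "x \<in> carrier X" for x
  proof (intro Cauchy_convergent CauchyI)
    fix e :: real assume "0 < e"
    have nonneg: "0 \<le> vnorm X x" by (rule vnorm_nonneg[OF x])
    with \<open>0 < e\<close> obtain N where
      N: "\<forall>m\<ge>N. \<forall>n\<ge>N. vnorm (dual X) (s m \<ominus>\<^bsub>dual X\<^esub> s n) < e / (vnorm X x + 1)"
      using cauchy[rule_format, of "e / (vnorm X x + 1)"] by auto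
    \<comment> \<open>Adding 1 keeps the quotient meaningful at norm zero and makes this inequality
      strict.\<close>
    have "e / (vnorm X x + 1) * vnorm X x < e"
      using \<open>0 < e\<close> nonneg by (simp add: field_simps)
    then show "\<exists>N. \<forall>m\<ge>N. \<forall>n\<ge>N. cmod (eval (s m) x - eval (s n) x) < e"
      using diff[OF _ x] N by (meson order_le_less_trans)
  qed
  then obtain f where f: "\<And>x. x \<in> carrier X \<Longrightarrow> (\<lambda>n. eval (s n) x) \<longlonglongrightarrow> f x"
    unfolding convergent_def by metis
  \<comment> \<open>This lets m tend to infinity in \<open>diff\<close> with n fixed. The index N
    comes from the Cauchy condition alone and so serves all x.\<close>
  have diff_lim: "\<exists>N. \<forall>n\<ge>N. \<forall>x\<in>carrier X. cmod (eval (s n) x - f x) \<le> e * vnorm X x"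
    if "0 < e" for e
  proof -
    obtain N where N: "\<forall>m\<ge>N. \<forall>n\<ge>N. vnorm (dual X) (s m \<ominus>\<^bsub>dual X\<^esub> s n) < e"
      using cauchy \<open>0 < e\<close> by blast
    have "cmod (eval (s n) x - f x) \<le> e * vnorm X x" if "n \<ge> N" "x \<in> carrier X" for n x
    proof (rule LIMSEQ_le_const2)
      show "(\<lambda>m. cmod (eval (s n) x - eval (s m) x)) \<longlonglongrightarrow> cmod (eval (s n) x - f x)"
        by (intro tendsto_intros f that)
      show "\<exists>M. \<forall>m\<ge>M. cmod (eval (s n) x - eval (s m) x) \<le> e * vnorm X x"
        using diff N that by blast
    qed
    then show ?thesis by blast
  qed
  \<comment> \<open>One functional \<open>s N\<close> within distance 1 of the limit is enough to
    bound \<open>f\<close>.\<close>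
  obtain N where N: "\<forall>n\<ge>N. \<forall>x\<in>carrier X. cmod (eval (s n) x - f x) \<le> 1 * vnorm X x"
    using diff_lim[of 1] by auto
  define \<phi> where "\<phi> = fun_code (carrier X) f"
  have \<phi>: "\<phi> \<in> carrier (dual X)"
    unfolding \<phi>_def
  proof (rule code_in_dualI[where K = "vnorm (dual X) (s N) + 1"])
    fix x y assume x: "x \<in> carrier X" and y: "y \<in> carrier X"
    have "(\<lambda>n. eval (s n) (x \<oplus> y)) \<longlonglongrightarrow> f x + f y"
      using tendsto_add[OF f[OF x] f[OF y]] by (simp add: eval_add s x y)
    then show "f (x \<oplus> y) = f x + f y"
      using f[of "x \<oplus> y"] x y LIMSEQ_unique by blast
  next
    fix c x assume x: "x \<in> carrier X"
    have "(\<lambda>n. eval (s n) (c \<odot> x)) \<longlonglongrightarrow> c * f x"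
      using tendsto_mult_left[OF f[OF x], of c] by (simp add: eval_smult s x)
    then show "f (c \<odot> x) = c * f x"
      using f[of "c \<odot> x"] x LIMSEQ_unique smult_closed' by blast
  next
    fix x assume x: "x \<in> carrier X"
    have "cmod (f x) \<le> cmod (eval (s N) x) + cmod (eval (s N) x - f x)"
      using norm_triangle_ineq4[of "eval (s N) x" "eval (s N) x - f x"] by simp
    also have "\<dots> \<le> vnorm (dual X) (s N) * vnorm X x + 1 * vnorm X x"
      using N x by (intro add_mono eval_le s) blast+
    finally show "cmod (f x) \<le> (vnorm (dual X) (s N) + 1) * vnorm X x"
      by (simp add: algebra_simps)
  qed
  have "(\<lambda>n. vnorm (dual X) (s n \<ominus>\<^bsub>dual X\<^esub> \<phi>)) \<longlonglongrightarrow> 0"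
  proof (rule LIMSEQ_I)
    fix e :: real assume "0 < e"
    \<comment> \<open>Half of e, since the estimates give only a weak inequality and the limit asks
      for a strict one.\<close>
    then obtain M where M: "\<forall>n\<ge>M. \<forall>x\<in>carrier X. cmod (eval (s n) x - f x) \<le> e / 2 * vnorm X x"
      using diff_lim[of "e / 2"] by auto
    have "vnorm (dual X) (s n \<ominus>\<^bsub>dual X\<^esub> \<phi>) \<le> e / 2" if "n \<ge> M" for n
      using M that \<open>0 < e\<close> by (intro dual_norm_le) (auto simp: eval_minus s \<phi>, simp add: \<phi>_def)
    then show "\<exists>M. \<forall>n\<ge>M. norm (vnorm (dual X) (s n \<ominus>\<^bsub>dual X\<^esub> \<phi>) - 0) < e"
      using \<open>0 < e\<close> D.vnorm_nonneg[OF D.minus_closed[OF s \<phi>]]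
      by (auto intro!: exI[of _ M] intro: order_le_less_trans[of _ "e / 2"])
  qed
  with \<phi> show "\<exists>\<phi>\<in>carrier (dual X). (\<lambda>n. vnorm (dual X) (s n \<ominus>\<^bsub>dual X\<^esub> \<phi>)) \<longlonglongrightarrow> 0"
    by blast
qed

end

section \<open>Adjoint operators\<close>

locale bounded_op = X: small_normed_space X + Y: small_normed_space Y
  for X Y :: "'v::zfc_model normed_space" and T :: "'v \<Rightarrow> 'v" +
  assumes bounded_op: "T \<in> bounded_ops X Y"
begin

lemma closed: "x \<in> carrier X \<Longrightarrow> T x \<in> carrier Y"
  by (rule bounded_opsD[OF bounded_op])

lemma adjoint_closed:
  assumes \<psi>: "\<psi> \<in> carrier (dual Y)"
  shows "adjoint X Y T \<psi> \<in> carrier (dual X)"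
proof -
  obtain K where K: "0 \<le> K" "\<And>x. x \<in> carrier X \<Longrightarrow> vnorm Y (T x) \<le> K * vnorm X x"
    using X.bounded_ops_bound[OF bounded_op] by blast
  have "fun_code (carrier X) (\<lambda>x. eval \<psi> (T x)) \<in> carrier (dual X)"
  proof (rule X.code_in_dualI[where K = "vnorm (dual Y) \<psi> * K"])
    fix x assume x: "x \<in> carrier X"
    have "cmod (eval \<psi> (T x)) \<le> vnorm (dual Y) \<psi> * vnorm Y (T x)"
      by (intro Y.eval_le \<psi> closed x)
    also have "\<dots> \<le> vnorm (dual Y) \<psi> * (K * vnorm X x)"
      by (intro mult_left_mono K x Y.dual_norm_nonneg \<psi>)
    finally show "cmod (eval \<psi> (T x)) \<le> vnorm (dual Y) \<psi> * K * vnorm X x"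
      by (simp add: mult.assoc)
  qed (simp_all add: bounded_opsD[OF bounded_op] closed Y.eval_add[OF \<psi>] Y.eval_smult[OF \<psi>])
  then show ?thesis
    using \<psi> by (simp add: adjoint_def)
qed

lemma eval_adjoint:
  "\<psi> \<in> carrier (dual Y) \<Longrightarrow> x \<in> carrier X \<Longrightarrow> eval (adjoint X Y T \<psi>) x = eval \<psi> (T x)"
  by (simp add: adjoint_def)

lemma adjoint_norm_le:
  assumes "0 \<le> K" "\<And>x. x \<in> carrier X \<Longrightarrow> vnorm Y (T x) \<le> K * vnorm X x"
    and \<psi>: "\<psi> \<in> carrier (dual Y)"
  shows "vnorm (dual X) (adjoint X Y T \<psi>) \<le> K * vnorm (dual Y) \<psi>"
proof (rule X.dual_norm_le)
  fix x assume x: "x \<in> carrier X"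
  have "cmod (eval \<psi> (T x)) \<le> vnorm (dual Y) \<psi> * vnorm Y (T x)"
    by (intro Y.eval_le \<psi> closed x)
  also have "\<dots> \<le> vnorm (dual Y) \<psi> * (K * vnorm X x)"
    by (intro mult_left_mono assms x Y.dual_norm_nonneg)
  finally show "cmod (eval (adjoint X Y T \<psi>) x) \<le> K * vnorm (dual Y) \<psi> * vnorm X x"
    using x \<psi> by (simp add: eval_adjoint mult_ac)
qed (simp add: assms Y.dual_norm_nonneg)

lemma adjoint_add:
  assumes "\<phi> \<in> carrier (dual Y)" "\<psi> \<in> carrier (dual Y)"
  shows "adjoint X Y T (\<phi> \<oplus>\<^bsub>dual Y\<^esub> \<psi>) = adjoint X Y T \<phi> \<oplus>\<^bsub>dual X\<^esub> adjoint X Y T \<psi>"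
  using assms
  by (intro X.dual_ext) (auto simp: eval_adjoint closed adjoint_closed X.dual_add_closed Y.dual_add_closed)

lemma adjoint_smult:
  assumes "\<phi> \<in> carrier (dual Y)"
  shows "adjoint X Y T (c \<odot>\<^bsub>dual Y\<^esub> \<phi>) = c \<odot>\<^bsub>dual X\<^esub> adjoint X Y T \<phi>"
  using assms
  by (intro X.dual_ext) (auto simp: eval_adjoint closed adjoint_closed X.dual_smult_closed Y.dual_smult_closed)

lemma bounded_op_adjoint: "bounded_op (dual Y) (dual X) (adjoint X Y T)"
proof (intro bounded_op.intro bounded_op_axioms.intro X.small_normed_space_dual
    Y.small_normed_space_dual)
  obtain K where K: "0 \<le> K" "\<And>x. x \<in> carrier X \<Longrightarrow> vnorm Y (T x) \<le> K * vnorm X x"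
    using X.bounded_ops_bound[OF bounded_op] by blast
  show "adjoint X Y T \<in> bounded_ops (dual Y) (dual X)"
  proof (rule bounded_opsI[where K = K])
    show "adjoint X Y T \<in> carrier (dual Y) \<rightarrow>\<^sub>E carrier (dual X)"
      using adjoint_closed by (auto simp: adjoint_def)
  qed (simp_all add: adjoint_add adjoint_smult adjoint_norm_le[OF K])
qed

end

lemma (in small_normed_space) bounded_op_id: "bounded_op X X (\<lambda>x\<in>carrier X. x)"
  by unfold_locales (rule id_bounded_ops)

lemma adjoint_id:
  assumes "small_normed_space X"
  shows "adjoint X X (\<lambda>x\<in>carrier X. x) = (\<lambda>\<phi>\<in>carrier (dual X). \<phi>)"
proof -
  interpret X: small_normed_space X by fact
  interpret bounded_op X X "\<lambda>x\<in>carrier X. x"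
    by (rule X.bounded_op_id)
  show ?thesis
  proof
    fix \<phi>
    show "adjoint X X (\<lambda>x\<in>carrier X. x) \<phi> = (\<lambda>\<phi>\<in>carrier (dual X). \<phi>) \<phi>"
    proof (cases "\<phi> \<in> carrier (dual X)")
      case True
      then have "adjoint X X (\<lambda>x\<in>carrier X. x) \<phi> = \<phi>"
        by (intro X.dual_ext adjoint_closed) (simp_all add: eval_adjoint)
      with True show ?thesis by simp
    qed (simp add: adjoint_def)
  qed
qed

lemma bounded_op_compose:
  assumes "bounded_op X Y S" "bounded_op Y Z T"
  shows "bounded_op X Z (compose (carrier X) T S)"
proof -
  interpret S: bounded_op X Y S by fact
  interpret T: bounded_op Y Z T by fact
  show ?thesis
    by unfold_locales
      (rule compose_bounded_ops[OF S.X.normed_space_axioms S.Y.normed_space_axioms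
          S.bounded_op T.bounded_op])
qed

text \<open>On the carrier, both sides evaluate at x to the functional at
  \<open>T (S x)\<close>.\<close>

lemma adjoint_compose:
  assumes "bounded_op X Y S" "bounded_op Y Z T"
  shows "adjoint X Z (compose (carrier X) T S) =
    compose (carrier (dual Z)) (adjoint X Y S) (adjoint Y Z T)"
proof
  interpret S: bounded_op X Y S by fact
  interpret T: bounded_op Y Z T by fact
  interpret TS: bounded_op X Z "compose (carrier X) T S"
    by (rule bounded_op_compose) fact+
  fix \<phi>
  show "adjoint X Z (compose (carrier X) T S) \<phi> =
    compose (carrier (dual Z)) (adjoint X Y S) (adjoint Y Z T) \<phi>"
  proof (cases "\<phi> \<in> carrier (dual Z)")
    case True
    then have "adjoint X Z (compose (carrier X) T S) \<phi> = adjoint X Y S (adjoint Y Z T \<phi>)"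
      by (intro S.X.dual_ext TS.adjoint_closed S.adjoint_closed T.adjoint_closed)
        (simp_all add: TS.eval_adjoint S.eval_adjoint T.eval_adjoint T.adjoint_closed S.closed
          compose_eq)
    with True show ?thesis by (simp add: compose_eq)
  \<comment> \<open>Off the carrier of \<open>dual Z\<close> both sides are
    \<open>undefined\<close>.\<close>
  qed (simp add: adjoint_def compose_def)
qed

section \<open>The canonical embedding into the bidual\<close>

context small_normed_space
begin

lemma eval_embedding:
  "x \<in> carrier X \<Longrightarrow> \<phi> \<in> carrier (dual X) \<Longrightarrow> eval (bidual_embedding X x) \<phi> = eval \<phi> x"
  by (simp add: bidual_embedding_def
      small_normed_space.eval_code[OF small_normed_space_dual])

text \<open>The estimate \<open>eval_le\<close>, read with the functional as the variable, bounds
  evaluation at x by the norm of x.\<close>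

lemma embedding_closed:
  assumes "x \<in> carrier X"
  shows "bidual_embedding X x \<in> carrier (bidual X)"
proof -
  interpret D: small_normed_space "dual X" by (rule small_normed_space_dual)
  have "fun_code (carrier (dual X)) (\<lambda>\<phi>. eval \<phi> x) \<in> carrier (bidual X)"
    using eval_le[OF _ assms] assms
    by (intro D.code_in_dualI[where K = "vnorm X x"]) (simp_all add: mult.commute)
  then show ?thesis
    using assms by (simp add: bidual_embedding_def)
qed

lemma bounded_op_embedding: "bounded_op X (bidual X) (bidual_embedding X)"
proof -
  interpret D: small_normed_space "dual X" by (rule small_normed_space_dual)
  interpret DD: small_normed_space "bidual X" by (rule D.small_normed_space_dual)
  have "bidual_embedding X \<in> bounded_ops X (bidual X)"
  proof (rule bounded_opsI[where K = 1])
    show "bidual_embedding X \<in> carrier X \<rightarrow>\<^sub>E carrier (bidual X)"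
      using embedding_closed by (auto simp: bidual_embedding_def)
  next
    fix x y assume "x \<in> carrier X" "y \<in> carrier X"
    then show "bidual_embedding X (x \<oplus> y) =
        bidual_embedding X x \<oplus>\<^bsub>bidual X\<^esub> bidual_embedding X y"
      by (intro D.dual_ext embedding_closed D.dual_add_closed)
        (simp_all add: eval_embedding eval_add)
  next
    fix c x assume "x \<in> carrier X"
    then show "bidual_embedding X (c \<odot> x) = c \<odot>\<^bsub>bidual X\<^esub> bidual_embedding X x"
      by (intro D.dual_ext embedding_closed D.dual_smult_closed)
        (simp_all add: eval_embedding eval_smult)
  next
    fix x assume x: "x \<in> carrier X"
    have "vnorm (bidual X) (bidual_embedding X x) \<le> vnorm X x"
      using eval_le[OF _ x] x
      by (intro D.dual_norm_le vnorm_nonneg) (simp_all add: eval_embedding mult.commute)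
    then show "vnorm (bidual X) (bidual_embedding X x) \<le> 1 * vnorm X x"
      by simp
  qed
  then show ?thesis
    by unfold_locales
qed

end

text \<open>Naturality of the embedding: at a functional \<psi> on \<open>Y\<close>, both sides have
  the value \<open>eval \<psi> (T x)\<close>.\<close>

lemma (in bounded_op) biadjoint_embedding:
  assumes "x \<in> carrier X"
  shows "adjoint (dual Y) (dual X) (adjoint X Y T) (bidual_embedding X x) =
    bidual_embedding Y (T x)"
proof -
  interpret A: bounded_op "dual Y" "dual X" "adjoint X Y T" by (rule bounded_op_adjoint)
  show ?thesis
    using assms
    by (intro A.X.dual_ext A.adjoint_closed)
      (simp_all add: A.eval_adjoint X.embedding_closed Y.embedding_closed X.eval_embedding
        Y.eval_embedding eval_adjoint adjoint_closed closed)
qed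

section \<open>The bidual tower\<close>

lemma (in small_normed_space) small_normed_space_tower: "small_normed_space (tower X n)"
  by (induction n) (simp_all add: small_normed_space_axioms small_normed_space.small_normed_space_dual)

lemma (in small_normed_space) bounded_op_tower_shift:
  "bounded_op (tower X n) (tower X (n + d)) (tower_shift X n d)"
proof (induction d)
  case 0
  interpret N: small_normed_space "tower X n" by (rule small_normed_space_tower)
  show ?case
    unfolding add_0_right tower_shift.simps by (rule N.bounded_op_id)
next
  case (Suc d)
  interpret N: small_normed_space "tower X (n + d)" by (rule small_normed_space_tower)
  show ?case
    using bounded_op_compose[OF Suc N.bounded_op_embedding] by simp
qed

context bounded_op
begin

lemma bounded_op_tower: "bounded_op (tower X n) (tower Y n) (tower_op X Y T n)"
  by (induction n) (simp_all add: bounded_op_axioms bounded_op.bounded_op_adjoint)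

lemma tower_op_norm_le:
  assumes "0 \<le> K" "\<And>x. x \<in> carrier X \<Longrightarrow> vnorm Y (T x) \<le> K * vnorm X x"
    and "x \<in> carrier (tower X n)"
  shows "vnorm (tower Y n) (tower_op X Y T n x) \<le> K * vnorm (tower X n) x"
  using assms(3)
proof (induction n arbitrary: x)
  case (Suc n)
  interpret N: bounded_op "tower X n" "tower Y n" "tower_op X Y T n" by (rule bounded_op_tower)
  show ?case
    \<comment> \<open>The inner instance turns the induction hypothesis into the bound K for the
      adjoint, the outer one into the same bound for the second adjoint.\<close>
    using bounded_op.adjoint_norm_le[OF N.bounded_op_adjoint assms(1)
        N.adjoint_norm_le[OF assms(1) Suc.IH]] Suc.prems
    by simp
qed (simp add: assms)

text \<open>The square of \<open>biadjoint_embedding\<close> at level n + d is pasted on at each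
  step of the induction. It is this commutation that makes the image of a compatible family
  compatible.\<close>

lemma tower_op_shift:
  assumes "x \<in> carrier (tower X n)"
  shows "tower_op X Y T (n + d) (tower_shift X n d x) = tower_shift Y n d (tower_op X Y T n x)"
proof (induction d)
  case 0
  then show ?case
    using assms bounded_op.closed[OF bounded_op_tower] by simp
next
  case (Suc d)
  then show ?case
    using assms bounded_op.biadjoint_embedding[OF bounded_op_tower, of _ "n + d"]
      bounded_op.closed[OF bounded_op_tower]
      bounded_op.closed[OF X.bounded_op_tower_shift]
    by (simp add: compose_eq)
qed

end

lemma tower_op_id:
  assumes "small_normed_space X"
  shows "tower_op X X (\<lambda>x\<in>carrier X. x) n = (\<lambda>x\<in>carrier (tower X n). x)"
proof (induction n)
  case (Suc n)
  have "small_normed_space (tower X n)"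
    by (rule small_normed_space.small_normed_space_tower) fact
  then show ?case
    by (simp only: tower.simps tower_op.simps Suc adjoint_id
        small_normed_space.small_normed_space_dual)
qed simp

text \<open>Each level takes two adjoints, which reverse the order of composition twice; the tower
  is covariant.\<close>

lemma tower_op_compose:
  assumes "bounded_op X Y S" "bounded_op Y Z T"
  shows "tower_op X Z (compose (carrier X) T S) n =
    compose (carrier (tower X n)) (tower_op Y Z T n) (tower_op X Y S n)"
proof (induction n)
  case (Suc n)
  note S = bounded_op.bounded_op_tower[OF assms(1), of n]
    and T = bounded_op.bounded_op_tower[OF assms(2), of n]
  show ?case
    by (simp add: Suc adjoint_compose[OF S T]
        adjoint_compose[OF bounded_op.bounded_op_adjoint[OF T] bounded_op.bounded_op_adjoint[OF S]])
qed simp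

section \<open>The inverse limit\<close>

lemma Inv_seqsD:
  assumes "\<phi> \<in> Inv_seqs X"
  shows "\<phi> n \<in> carrier (dual (tower X n))"
    and "bdd_above (range (\<lambda>n. vnorm (dual (tower X n)) (\<phi> n)))"
  using assms by (auto simp: Inv_seqs_def)

lemma seq_nth_seq_code' [simp]: "seq_nth (seq_code s) = s"
  by (rule ext) (rule seq_nth_seq_code)

text \<open>\<open>seq_nth\<close> is defined on the whole model, so an element may have the
  components of a compatible family without being a code. The second conjunct excludes this and
  yields \<open>Inv_ext\<close>.\<close>

lemma carrier_Inv_iff:
  "\<phi> \<in> carrier (Inv X) \<longleftrightarrow> seq_nth \<phi> \<in> Inv_seqs X \<and> seq_code (seq_nth \<phi>) = \<phi>"
  by (auto simp: Inv_def intro!: image_eqI)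

lemma seq_code_in_Inv: "seq_code s \<in> carrier (Inv X) \<longleftrightarrow> s \<in> Inv_seqs X"
  by (simp add: carrier_Inv_iff)

lemma Inv_nth_closed: "\<phi> \<in> carrier (Inv X) \<Longrightarrow> seq_nth \<phi> n \<in> carrier (dual (tower X n))"
  using Inv_seqsD(1) carrier_Inv_iff by blast

lemma Inv_ext:
  assumes "\<phi> \<in> carrier (Inv X)" "\<psi> \<in> carrier (Inv X)" "\<And>n. seq_nth \<phi> n = seq_nth \<psi> n"
  shows "\<phi> = \<psi>"
  using assms by (metis carrier_Inv_iff ext)

lemma Inv_simps:
  "\<zero>\<^bsub>Inv X\<^esub> = seq_code (\<lambda>n. \<zero>\<^bsub>dual (tower X n)\<^esub>)"
  "\<phi> \<oplus>\<^bsub>Inv X\<^esub> \<psi> = seq_code (\<lambda>n. seq_nth \<phi> n \<oplus>\<^bsub>dual (tower X n)\<^esub> seq_nth \<psi> n)"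
  "c \<odot>\<^bsub>Inv X\<^esub> \<phi> = seq_code (\<lambda>n. c \<odot>\<^bsub>dual (tower X n)\<^esub> seq_nth \<phi> n)"
  by (simp_all add: Inv_def)

lemma Inv_norm_le:
  assumes "\<And>n. vnorm (dual (tower X n)) (seq_nth \<phi> n) \<le> K"
  shows "vnorm (Inv X) \<phi> \<le> K"
  using assms by (auto simp: Inv_def intro: cSUP_least)

lemma Inv_nth_norm_le:
  assumes "\<phi> \<in> carrier (Inv X)"
  shows "vnorm (dual (tower X n)) (seq_nth \<phi> n) \<le> vnorm (Inv X) \<phi>"
  using assms by (auto simp: Inv_def carrier_Inv_iff intro!: cSUP_upper Inv_seqsD)

section \<open>The inverse limit as a Banach space\<close>

context small_normed_space
begin

text \<open>By \<open>dual_ext\<close>, the equation between functionals amounts to equations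
  between complex values, which are stable under sums, multiples and pointwise limits.\<close>

lemma Inv_seqs_iff:
  "\<phi> \<in> Inv_seqs X \<longleftrightarrow>
    (\<forall>n. \<phi> n \<in> carrier (dual (tower X n))) \<and>
    (\<forall>n d. \<forall>x\<in>carrier (tower X n). eval (\<phi> n) x = eval (\<phi> (n + d)) (tower_shift X n d x)) \<and>
    (\<exists>K. \<forall>n. vnorm (dual (tower X n)) (\<phi> n) \<le> K)"
proof -
  have "\<phi> n = adjoint (tower X n) (tower X (n + d)) (tower_shift X n d) (\<phi> (n + d)) \<longleftrightarrow>
      (\<forall>x\<in>carrier (tower X n). eval (\<phi> n) x = eval (\<phi> (n + d)) (tower_shift X n d x))"
    if "\<forall>n. \<phi> n \<in> carrier (dual (tower X n))" for n d
  proof -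
    interpret bounded_op "tower X n" "tower X (n + d)" "tower_shift X n d"
      by (rule bounded_op_tower_shift)
    show ?thesis
      using that X.dual_ext adjoint_closed eval_adjoint by metis
  qed
  \<comment> \<open>Each m with n \<le> m is n + d for d = m - n, the height that
    \<open>kappa\<close> passes to \<open>tower_shift\<close>.\<close>
  moreover have "(\<forall>n m. n \<le> m \<longrightarrow> \<phi> n = adjoint (tower X n) (tower X m) (kappa X n m) (\<phi> m)) \<longleftrightarrow>
      (\<forall>n d. \<phi> n = adjoint (tower X n) (tower X (n + d)) (tower_shift X n d) (\<phi> (n + d)))"
    unfolding kappa_def by (metis add_diff_cancel_left' le_add1 le_Suc_ex)
  ultimately show ?thesis
    unfolding Inv_seqs_def bdd_above_def by auto
qed

lemma Inv_closed:
  shows Inv_zero_closed: "\<zero>\<^bsub>Inv X\<^esub> \<in> carrier (Inv X)"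
    and Inv_add_closed: "\<phi> \<in> carrier (Inv X) \<Longrightarrow> \<psi> \<in> carrier (Inv X) \<Longrightarrow>
      \<phi> \<oplus>\<^bsub>Inv X\<^esub> \<psi> \<in> carrier (Inv X)"
    and Inv_smult_closed: "\<phi> \<in> carrier (Inv X) \<Longrightarrow> c \<odot>\<^bsub>Inv X\<^esub> \<phi> \<in> carrier (Inv X)"
proof -
  interpret N: small_normed_space "tower X n" for n by (rule small_normed_space_tower)
  interpret D: normed_space "dual (tower X n)" for n by (rule N.normed_space_dual)
  have shift: "tower_shift X n d x \<in> carrier (tower X (n + d))" if "x \<in> carrier (tower X n)" for n d x
    using bounded_op.closed[OF bounded_op_tower_shift that] .
  have compat: "eval (seq_nth \<phi> (n + d)) (tower_shift X n d x) = eval (seq_nth \<phi> n) x"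
    if "\<phi> \<in> carrier (Inv X)" "x \<in> carrier (tower X n)" for \<phi> n d x
    using that unfolding carrier_Inv_iff Inv_seqs_iff by metis
  have "vnorm (dual (tower X n)) \<zero>\<^bsub>dual (tower X n)\<^esub> = 0" for n
    by (simp add: D.vnorm_eq_0)
  then show "\<zero>\<^bsub>Inv X\<^esub> \<in> carrier (Inv X)"
    unfolding Inv_simps seq_code_in_Inv Inv_seqs_iff by (auto simp: shift intro!: exI[of _ 0])
  assume \<phi>: "\<phi> \<in> carrier (Inv X)"
  show "c \<odot>\<^bsub>Inv X\<^esub> \<phi> \<in> carrier (Inv X)"
    unfolding Inv_simps seq_code_in_Inv Inv_seqs_iff
    by (auto simp: shift compat[OF \<phi>] Inv_nth_closed[OF \<phi>] D.vnorm_smult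
        intro!: exI[of _ "cmod c * vnorm (Inv X) \<phi>"] mult_left_mono Inv_nth_norm_le \<phi>)
  assume \<psi>: "\<psi> \<in> carrier (Inv X)"
  have "vnorm (dual (tower X n)) (seq_nth \<phi> n \<oplus>\<^bsub>dual (tower X n)\<^esub> seq_nth \<psi> n) \<le>
      vnorm (Inv X) \<phi> + vnorm (Inv X) \<psi>" for n
    by (intro order_trans[OF D.vnorm_triangle] add_mono Inv_nth_norm_le Inv_nth_closed \<phi> \<psi>)
  then show "\<phi> \<oplus>\<^bsub>Inv X\<^esub> \<psi> \<in> carrier (Inv X)"
    unfolding Inv_simps seq_code_in_Inv Inv_seqs_iff
    by (auto simp: shift compat[OF \<phi>] compat[OF \<psi>] Inv_nth_closed[OF \<phi>] Inv_nth_closed[OF \<psi>])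
qed

lemma normed_space_Inv: "normed_space (Inv X)"
proof -
  interpret N: small_normed_space "tower X n" for n by (rule small_normed_space_tower)
  interpret D: normed_space "dual (tower X n)" for n by (rule N.normed_space_dual)
  have nonneg: "0 \<le> vnorm (Inv X) \<phi>" if "\<phi> \<in> carrier (Inv X)" for \<phi>
    using that by (intro order_trans[OF D.vnorm_nonneg Inv_nth_norm_le] Inv_nth_closed)
  show ?thesis
  proof (rule normed_spaceI)
    fix \<phi> assume \<phi>: "\<phi> \<in> carrier (Inv X)" and "vnorm (Inv X) \<phi> = 0"
    then have "vnorm (dual (tower X n)) (seq_nth \<phi> n) = 0" for n
      using Inv_nth_norm_le[OF \<phi>, of n] D.vnorm_nonneg[OF Inv_nth_closed[OF \<phi>], of n] by simp
    then show "\<phi> = \<zero>\<^bsub>Inv X\<^esub>"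
      by (intro Inv_ext[OF \<phi> Inv_zero_closed])
        (simp add: Inv_simps D.vnorm_eq_0[OF Inv_nth_closed[OF \<phi>], symmetric])
  next
    fix c \<phi> assume \<phi>: "\<phi> \<in> carrier (Inv X)"
    show "vnorm (Inv X) (c \<odot>\<^bsub>Inv X\<^esub> \<phi>) \<le> cmod c * vnorm (Inv X) \<phi>"
      by (rule Inv_norm_le)
        (auto simp: Inv_simps D.vnorm_smult Inv_nth_closed[OF \<phi>]
          intro!: mult_left_mono Inv_nth_norm_le \<phi>)
  next
    fix \<phi> \<psi> assume "\<phi> \<in> carrier (Inv X)" "\<psi> \<in> carrier (Inv X)"
    then show "vnorm (Inv X) (\<phi> \<oplus>\<^bsub>Inv X\<^esub> \<psi>) \<le> vnorm (Inv X) \<phi> + vnorm (Inv X) \<psi>"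
      by (intro Inv_norm_le)
        (auto simp: Inv_simps
          intro!: order_trans[OF D.vnorm_triangle] add_mono Inv_nth_norm_le Inv_nth_closed)
  \<comment> \<open>The first alternative settles closure and nonnegativity; the second proves the
    vector space identities in each component.\<close>
  qed ((intro Inv_closed nonneg; assumption) |
      (rule Inv_ext[where X = X]; (intro Inv_closed; assumption)?;
        simp add: Inv_simps Inv_nth_closed D.a_assoc D.a_comm D.a_lcomm D.smult_add D.smult_add_distrib
          D.smult_mult))+
qed

text \<open>Compatible families lie in the countable product of the dual carriers, each of them
  small.\<close>

lemma small_Inv: "small (carrier (Inv X))"
proof (rule small_subset)
  show "carrier (Inv X) \<subseteq> seq_code ` {s. \<forall>n. s n \<in> carrier (dual (tower X n))}"
    by (auto simp: Inv_def Inv_seqs_def)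
  show "small (seq_code ` {s. \<forall>n. s n \<in> carrier (dual (tower X n))})"
    by (intro small_seq_codes small_normed_space.small_carrier
        small_normed_space.small_normed_space_dual small_normed_space_tower)
qed

lemma Inv_minus:
  assumes "\<phi> \<in> carrier (Inv X)" "\<psi> \<in> carrier (Inv X)"
  shows "seq_nth (\<phi> \<ominus>\<^bsub>Inv X\<^esub> \<psi>) n = seq_nth \<phi> n \<ominus>\<^bsub>dual (tower X n)\<^esub> seq_nth \<psi> n"
proof -
  interpret N: small_normed_space "tower X n" by (rule small_normed_space_tower)
  interpret D: normed_space "dual (tower X n)" by (rule N.normed_space_dual)
  show ?thesis
    using assms
    by (simp add: normed_space.minus_eq_smult[OF normed_space_Inv] D.minus_eq_smult Inv_nth_closed
        Inv_simps)
qed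

lemma banach_space_Inv: "banach_space (Inv X)"
proof (intro banach_space.intro banach_space_axioms.intro normed_space_Inv)
  interpret N: small_normed_space "tower X n" for n by (rule small_normed_space_tower)
  interpret D: banach_space "dual (tower X n)" for n by (rule N.banach_space_dual)
  interpret I: normed_space "Inv X" by (rule normed_space_Inv)
  fix s :: "nat \<Rightarrow> 'v"
  assume "range s \<subseteq> carrier (Inv X)"
    and cauchy: "\<forall>e>0. \<exists>M. \<forall>j\<ge>M. \<forall>k\<ge>M. vnorm (Inv X) (s j \<ominus>\<^bsub>Inv X\<^esub> s k) < e"
  then have s: "s k \<in> carrier (Inv X)" for k by auto
  note s_nth = Inv_nth_closed[OF s]
  define diff where "diff k n \<psi> = vnorm (dual (tower X n)) (seq_nth (s k) n \<ominus>\<^bsub>dual (tower X n)\<^esub> \<psi>)"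
    for k n \<psi>
  have diff_le: "diff j n (seq_nth (s k) n) \<le> vnorm (Inv X) (s j \<ominus>\<^bsub>Inv X\<^esub> s k)" for j k n
    using Inv_nth_norm_le[OF I.minus_closed[OF s s], of n j k]
    by (simp add: diff_def Inv_minus s)
  have "\<exists>\<psi>\<in>carrier (dual (tower X n)). (\<lambda>k. diff k n \<psi>) \<longlonglongrightarrow> 0" for n
    unfolding diff_def
  proof (rule D.complete)
    show "range (\<lambda>k. seq_nth (s k) n) \<subseteq> carrier (dual (tower X n))"
      using s_nth by auto
    show "\<forall>e>0. \<exists>M. \<forall>j\<ge>M. \<forall>k\<ge>M.
        vnorm (dual (tower X n)) (seq_nth (s j) n \<ominus>\<^bsub>dual (tower X n)\<^esub> seq_nth (s k) n) < e"
      using cauchy diff_le unfolding diff_def by (meson order_le_less_trans)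
  qed
  then obtain \<phi> where \<phi>: "\<And>n. \<phi> n \<in> carrier (dual (tower X n))"
    and lim: "\<And>n. (\<lambda>k. diff k n (\<phi> n)) \<longlonglongrightarrow> 0"
    by metis
  \<comment> \<open>Norm convergence at level n gives pointwise convergence, as
    \<open>eval_le\<close> bounds the difference of values.\<close>
  have eval_lim: "(\<lambda>k. eval (seq_nth (s k) n) x) \<longlonglongrightarrow> eval (\<phi> n) x"
    if x: "x \<in> carrier (tower X n)" for n x
  proof (rule LIM_zero_cancel, rule tendsto_0_le[OF lim])
    show "\<forall>\<^sub>F k in sequentially. norm (eval (seq_nth (s k) n) x - eval (\<phi> n) x) \<le>
        norm (diff k n (\<phi> n)) * vnorm (tower X n) x"
      using N.eval_le[OF D.minus_closed[OF s_nth \<phi>] x] D.vnorm_nonneg[OF D.minus_closed[OF s_nth \<phi>]]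
      by (simp add: N.eval_minus s_nth \<phi> x diff_def)
  qed
  have diff_triangle: "diff j n (\<phi> n) \<le> vnorm (Inv X) (s j \<ominus>\<^bsub>Inv X\<^esub> s k) + diff k n (\<phi> n)" for j k n
  proof -
    have "seq_nth (s j) n \<ominus>\<^bsub>dual (tower X n)\<^esub> \<phi> n =
        (seq_nth (s j) n \<ominus>\<^bsub>dual (tower X n)\<^esub> seq_nth (s k) n) \<oplus>\<^bsub>dual (tower X n)\<^esub>
        (seq_nth (s k) n \<ominus>\<^bsub>dual (tower X n)\<^esub> \<phi> n)"
      by (intro N.dual_ext[where n = n]) (simp_all add: N.eval_minus s_nth \<phi>)
    then have "diff j n (\<phi> n) \<le> diff j n (seq_nth (s k) n) + diff k n (\<phi> n)"
      using D.vnorm_triangle[OF D.minus_closed[OF s_nth s_nth] D.minus_closed[OF s_nth \<phi>]]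
      by (simp add: diff_def)
    also have "\<dots> \<le> vnorm (Inv X) (s j \<ominus>\<^bsub>Inv X\<^esub> s k) + diff k n (\<phi> n)"
      by (intro add_right_mono diff_le)
    finally show ?thesis .
  qed
  \<comment> \<open>With j and n fixed, k tends to infinity in \<open>diff_triangle\<close>. M is
    chosen from the norm of \<open>Inv X\<close>, before n, and therefore works at every
    level.\<close>
  have uniform: "\<exists>M. \<forall>j\<ge>M. \<forall>n. diff j n (\<phi> n) \<le> e" if "0 < e" for e
  proof -
    obtain M where M: "\<forall>j\<ge>M. \<forall>k\<ge>M. vnorm (Inv X) (s j \<ominus>\<^bsub>Inv X\<^esub> s k) < e"
      using cauchy \<open>0 < e\<close> by blast
    have "diff j n (\<phi> n) \<le> e" if "j \<ge> M" for j n
    proof (rule LIMSEQ_le_const)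
      show "(\<lambda>k. e + diff k n (\<phi> n)) \<longlonglongrightarrow> e"
        using tendsto_add[OF tendsto_const lim] by simp
      have "diff j n (\<phi> n) \<le> e + diff k n (\<phi> n)" if "k \<ge> M" for k
        using diff_triangle[of j n k] M \<open>j \<ge> M\<close> that by (meson add_right_mono less_imp_le order_trans)
      then show "\<exists>M. \<forall>k\<ge>M. diff j n (\<phi> n) \<le> e + diff k n (\<phi> n)"
        by blast
    qed
    then show ?thesis by blast
  qed
  have "\<phi> \<in> Inv_seqs X"
    unfolding Inv_seqs_iff
  proof (intro conjI allI ballI \<phi>)
    fix n d x assume x: "x \<in> carrier (tower X n)"
    have "eval (seq_nth (s k) n) x = eval (seq_nth (s k) (n + d)) (tower_shift X n d x)" for k
      using s[of k] x unfolding carrier_Inv_iff Inv_seqs_iff by blast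
    then show "eval (\<phi> n) x = eval (\<phi> (n + d)) (tower_shift X n d x)"
      using eval_lim[OF x] eval_lim[OF bounded_op.closed[OF bounded_op_tower_shift x, of d]]
      by (simp add: LIMSEQ_unique)
  next
    \<comment> \<open>A single member \<open>s M\<close>, within distance 1 of the limit at all
      levels, bounds the norms of all components of \<phi> at once.\<close>
    obtain M where M: "\<forall>j\<ge>M. \<forall>n. diff j n (\<phi> n) \<le> 1"
      using uniform[of 1] by auto
    have "vnorm (dual (tower X n)) (\<phi> n) \<le> vnorm (Inv X) (s M) + 1" for n
    proof (rule N.dual_norm_le)
      fix x assume x: "x \<in> carrier (tower X n)"
      have "cmod (eval (\<phi> n) x) \<le>
          cmod (eval (seq_nth (s M) n) x) + cmod (eval (seq_nth (s M) n) x - eval (\<phi> n) x)"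
        using norm_triangle_ineq4[of "eval (seq_nth (s M) n) x"
            "eval (seq_nth (s M) n) x - eval (\<phi> n) x"] by simp
      also have "\<dots> \<le> vnorm (dual (tower X n)) (seq_nth (s M) n) * vnorm (tower X n) x +
          diff M n (\<phi> n) * vnorm (tower X n) x"
        using N.eval_le[OF D.minus_closed[OF s_nth \<phi>] x, of M]
        by (intro add_mono N.eval_le s_nth x) (simp add: N.eval_minus s_nth \<phi> x diff_def)
      also have "\<dots> \<le> vnorm (Inv X) (s M) * vnorm (tower X n) x + 1 * vnorm (tower X n) x"
        using M by (intro add_mono mult_right_mono N.vnorm_nonneg x Inv_nth_norm_le s) blast
      finally show "cmod (eval (\<phi> n) x) \<le> (vnorm (Inv X) (s M) + 1) * vnorm (tower X n) x"
        by (simp add: algebra_simps)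
    qed (simp add: add_nonneg_nonneg I.vnorm_nonneg s)
    then show "\<exists>K. \<forall>n. vnorm (dual (tower X n)) (\<phi> n) \<le> K"
      by blast
  qed
  then have \<Phi>: "seq_code \<phi> \<in> carrier (Inv X)"
    by (simp add: seq_code_in_Inv)
  have "(\<lambda>k. vnorm (Inv X) (s k \<ominus>\<^bsub>Inv X\<^esub> seq_code \<phi>)) \<longlonglongrightarrow> 0"
  proof (rule LIMSEQ_I)
    fix e :: real assume "0 < e"
    then obtain M where M: "\<forall>j\<ge>M. \<forall>n. diff j n (\<phi> n) \<le> e / 2"
      using uniform[of "e / 2"] by auto
    have "vnorm (Inv X) (s k \<ominus>\<^bsub>Inv X\<^esub> seq_code \<phi>) \<le> e / 2" if "k \<ge> M" for k
      using M that by (intro Inv_norm_le) (simp add: Inv_minus s \<Phi> diff_def)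
    then show "\<exists>M. \<forall>k\<ge>M. norm (vnorm (Inv X) (s k \<ominus>\<^bsub>Inv X\<^esub> seq_code \<phi>) - 0) < e"
      using \<open>0 < e\<close> I.vnorm_nonneg[OF I.minus_closed[OF s \<Phi>]]
      by (auto intro!: exI[of _ M] intro: order_le_less_trans[of _ "e / 2"])
  qed
  with \<Phi> show "\<exists>\<phi>\<in>carrier (Inv X). (\<lambda>k. vnorm (Inv X) (s k \<ominus>\<^bsub>Inv X\<^esub> \<phi>)) \<longlonglongrightarrow> 0"
    by blast
qed

end

section \<open>The action of the inverse limit on operators\<close>

context bounded_op
begin

lemma Inv_map_apply:
  "\<phi> \<in> carrier (Inv Y) \<Longrightarrow> seq_nth (Inv_map X Y T \<phi>) n =
    adjoint (tower X n) (tower Y n) (tower_op X Y T n) (seq_nth \<phi> n)"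
  by (simp add: Inv_map_def)

lemma Inv_map_nth_norm_le:
  assumes "0 \<le> K" "\<And>x. x \<in> carrier X \<Longrightarrow> vnorm Y (T x) \<le> K * vnorm X x"
    and \<phi>: "\<phi> \<in> carrier (Inv Y)"
  shows "vnorm (dual (tower X n)) (seq_nth (Inv_map X Y T \<phi>) n) \<le> K * vnorm (Inv Y) \<phi>"
proof -
  interpret N: bounded_op "tower X n" "tower Y n" "tower_op X Y T n" by (rule bounded_op_tower)
  have "vnorm (dual (tower X n)) (seq_nth (Inv_map X Y T \<phi>) n) \<le>
      K * vnorm (dual (tower Y n)) (seq_nth \<phi> n)"
    unfolding Inv_map_apply[OF \<phi>]
    by (intro N.adjoint_norm_le tower_op_norm_le Inv_nth_closed assms)
  also have "\<dots> \<le> K * vnorm (Inv Y) \<phi>"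
    by (intro mult_left_mono Inv_nth_norm_le assms)
  finally show ?thesis .
qed

lemma Inv_map_closed:
  assumes \<phi>: "\<phi> \<in> carrier (Inv Y)"
  shows "Inv_map X Y T \<phi> \<in> carrier (Inv X)"
proof -
  interpret N: bounded_op "tower X n" "tower Y n" "tower_op X Y T n" for n
    by (rule bounded_op_tower)
  note \<phi>_nth = Inv_nth_closed[OF \<phi>]
  obtain K where K: "0 \<le> K" "\<And>x. x \<in> carrier X \<Longrightarrow> vnorm Y (T x) \<le> K * vnorm X x"
    using X.bounded_ops_bound[OF bounded_op] by blast
  have "seq_nth (Inv_map X Y T \<phi>) \<in> Inv_seqs X"
    unfolding X.Inv_seqs_iff
  proof (intro conjI allI ballI exI)
    show "seq_nth (Inv_map X Y T \<phi>) n \<in> carrier (dual (tower X n))" for n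
      by (simp add: Inv_map_apply \<phi> N.adjoint_closed \<phi>_nth)
    show "vnorm (dual (tower X n)) (seq_nth (Inv_map X Y T \<phi>) n) \<le> K * vnorm (Inv Y) \<phi>" for n
      by (rule Inv_map_nth_norm_le[OF K \<phi>])
  next
    fix n d x assume x: "x \<in> carrier (tower X n)"
    then have "tower_shift X n d x \<in> carrier (tower X (n + d))"
      by (rule bounded_op.closed[OF X.bounded_op_tower_shift])
    \<comment> \<open>Compatibility of \<phi> over \<open>Y\<close>, used at the image of x;
      \<open>tower_op_shift\<close> then moves the operator past the shift.\<close>
    moreover have "eval (seq_nth \<phi> n) (tower_op X Y T n x) =
        eval (seq_nth \<phi> (n + d)) (tower_shift Y n d (tower_op X Y T n x))"
      using \<phi> N.closed[OF x] unfolding carrier_Inv_iff Y.Inv_seqs_iff by blast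
    ultimately show "eval (seq_nth (Inv_map X Y T \<phi>) n) x =
        eval (seq_nth (Inv_map X Y T \<phi>) (n + d)) (tower_shift X n d x)"
      using x by (simp add: Inv_map_apply \<phi> N.eval_adjoint \<phi>_nth tower_op_shift)
  qed
  then show ?thesis
    using \<phi> by (simp add: Inv_map_def seq_code_in_Inv)
qed

lemma Inv_map_bounded_ops: "Inv_map X Y T \<in> bounded_ops (Inv Y) (Inv X)"
proof -
  interpret N: bounded_op "tower X n" "tower Y n" "tower_op X Y T n" for n
    by (rule bounded_op_tower)
  obtain K where K: "0 \<le> K" "\<And>x. x \<in> carrier X \<Longrightarrow> vnorm Y (T x) \<le> K * vnorm X x"
    using X.bounded_ops_bound[OF bounded_op] by blast
  show ?thesis
  proof (rule bounded_opsI[where K = K])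
    show "Inv_map X Y T \<in> carrier (Inv Y) \<rightarrow>\<^sub>E carrier (Inv X)"
      using Inv_map_closed by (auto simp: Inv_map_def)
  next
    fix \<phi> \<psi> assume *: "\<phi> \<in> carrier (Inv Y)" "\<psi> \<in> carrier (Inv Y)"
    then have "Inv_map X Y T (\<phi> \<oplus>\<^bsub>Inv Y\<^esub> \<psi>) \<in> carrier (Inv X)"
      and "Inv_map X Y T \<phi> \<oplus>\<^bsub>Inv X\<^esub> Inv_map X Y T \<psi> \<in> carrier (Inv X)"
      by (simp_all add: Inv_map_closed X.Inv_add_closed Y.Inv_add_closed)
    moreover have "seq_nth (Inv_map X Y T (\<phi> \<oplus>\<^bsub>Inv Y\<^esub> \<psi>)) n =
        seq_nth (Inv_map X Y T \<phi> \<oplus>\<^bsub>Inv X\<^esub> Inv_map X Y T \<psi>) n" for n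
      unfolding Inv_map_apply[OF Y.Inv_add_closed[OF *]]
      using * by (simp add: Inv_simps Inv_map_apply N.adjoint_add Inv_nth_closed)
    ultimately show "Inv_map X Y T (\<phi> \<oplus>\<^bsub>Inv Y\<^esub> \<psi>) = Inv_map X Y T \<phi> \<oplus>\<^bsub>Inv X\<^esub> Inv_map X Y T \<psi>"
      by (rule Inv_ext)
  next
    fix c \<phi> assume *: "\<phi> \<in> carrier (Inv Y)"
    then have "Inv_map X Y T (c \<odot>\<^bsub>Inv Y\<^esub> \<phi>) \<in> carrier (Inv X)"
      and "c \<odot>\<^bsub>Inv X\<^esub> Inv_map X Y T \<phi> \<in> carrier (Inv X)"
      by (simp_all add: Inv_map_closed X.Inv_smult_closed Y.Inv_smult_closed)
    moreover have "seq_nth (Inv_map X Y T (c \<odot>\<^bsub>Inv Y\<^esub> \<phi>)) n =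
        seq_nth (c \<odot>\<^bsub>Inv X\<^esub> Inv_map X Y T \<phi>) n" for n
      unfolding Inv_map_apply[OF Y.Inv_smult_closed[OF *]]
      using * by (simp add: Inv_simps Inv_map_apply N.adjoint_smult Inv_nth_closed)
    ultimately show "Inv_map X Y T (c \<odot>\<^bsub>Inv Y\<^esub> \<phi>) = c \<odot>\<^bsub>Inv X\<^esub> Inv_map X Y T \<phi>"
      by (rule Inv_ext)
  next
    fix \<phi> assume "\<phi> \<in> carrier (Inv Y)"
    then show "vnorm (Inv X) (Inv_map X Y T \<phi>) \<le> K * vnorm (Inv Y) \<phi>"
      by (intro Inv_norm_le Inv_map_nth_norm_le K)
  qed
qed

end

text \<open>At every level the operator is an adjoint of an identity, and an element of the carrier
  is the code of its own components.\<close>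

lemma Inv_map_id:
  assumes "small_normed_space X"
  shows "Inv_map X X (\<lambda>x\<in>carrier X. x) = (\<lambda>\<phi>\<in>carrier (Inv X). \<phi>)"
  using assms
  by (auto simp: Inv_map_def tower_op_id adjoint_id small_normed_space.small_normed_space_tower
      Inv_nth_closed carrier_Inv_iff intro!: restrict_ext)

lemma Inv_map_compose:
  assumes "bounded_op X Y S" "bounded_op Y Z T"
  shows "Inv_map X Z (compose (carrier X) T S) =
    compose (carrier (Inv Z)) (Inv_map X Y S) (Inv_map Y Z T)"
proof
  interpret T: bounded_op Y Z T by fact
  note St = bounded_op.bounded_op_tower[OF assms(1)] and Tt = T.bounded_op_tower
  fix \<phi>
  show "Inv_map X Z (compose (carrier X) T S) \<phi> =
    compose (carrier (Inv Z)) (Inv_map X Y S) (Inv_map Y Z T) \<phi>"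
  proof (cases "\<phi> \<in> carrier (Inv Z)")
    case True
    note TS = tower_op_compose[OF assms] adjoint_compose[OF St Tt]
    \<comment> \<open>Only the outer map is unfolded: its restriction resolves because the inner
      value lies in the carrier of \<open>Inv Y\<close>.\<close>
    have "Inv_map X Y S (Inv_map Y Z T \<phi>) = seq_code (\<lambda>n.
        adjoint (tower X n) (tower Y n) (tower_op X Y S n) (seq_nth (Inv_map Y Z T \<phi>) n))"
      using T.Inv_map_closed[OF True] by (simp add: Inv_map_def)
    with True show ?thesis
      by (simp add: T.Inv_map_apply compose_eq Inv_nth_closed)
        (simp add: Inv_map_def TS compose_eq Inv_nth_closed)
  qed (simp add: Inv_map_def compose_def)
qed

section \<open>The category of Banach spaces and the functor laws\<close>

lemma Obj_Ban_iff:
  "X \<in> Obj Ban \<longleftrightarrow> banach_space X \<and> small_normed_space X"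
  by (auto simp: Ban_def small_normed_space_def small_normed_space_axioms_def banach_space_def)

lemma bounded_op_iff_Hom:
  assumes "X \<in> Obj Ban" "Y \<in> Obj Ban"
  shows "bounded_op X Y T \<longleftrightarrow> T \<in> Hom Ban X Y"
  using assms unfolding Obj_Ban_iff
  by (simp add: Ban_def bounded_op_def bounded_op_axioms_def)

lemma Ban_simps:
  "Hom Ban = bounded_ops" "Id Ban X = (\<lambda>x\<in>carrier X. x)"
  "Comp Ban X Y Z g f = compose (carrier X) g f"
  by (simp_all add: Ban_def)

lemma category_Ban: "category Ban"
proof
  fix X :: "'v::zfc_model normed_space" assume "X \<in> Obj Ban"
  then show "Id Ban X \<in> Hom Ban X X"
    by (simp add: Ban_simps Obj_Ban_iff banach_space_def normed_space.id_bounded_ops)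
next
  fix X Y Z :: "'v::zfc_model normed_space" and f g
  assume "X \<in> Obj Ban" "Y \<in> Obj Ban" "Z \<in> Obj Ban" "f \<in> Hom Ban X Y" "g \<in> Hom Ban Y Z"
  then show "Comp Ban X Y Z g f \<in> Hom Ban X Z"
    by (auto simp: Ban_simps Obj_Ban_iff banach_space_def intro: compose_bounded_ops)
next
  fix X Y :: "'v::zfc_model normed_space" and f
  assume "f \<in> Hom Ban X Y"
  then have f: "f \<in> carrier X \<rightarrow> carrier Y" "f \<in> extensional (carrier X)"
    using bounded_opsD by (fastforce simp: Ban_simps)+
  \<comment> \<open>Extensionality of \<open>f\<close> is what makes these restricted composites
    equal to \<open>f\<close> also off the carrier.\<close>
  show "Comp Ban X X Y f (Id Ban X) = f" "Comp Ban X Y Y (Id Ban Y) f = f"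
    using f by (simp_all add: Ban_simps compose_Id Id_compose)
next
  fix W X Y Z :: "'v::zfc_model normed_space" and f g h
  assume "f \<in> Hom Ban W X"
  \<comment> \<open>On the left the inner composite is restricted to the carrier of
    \<open>X\<close>, so the values of \<open>f\<close> must lie there.\<close>
  then show "Comp Ban W X Z (Comp Ban X Y Z h g) f = Comp Ban W Y Z h (Comp Ban W X Y g f)"
    using bounded_opsD(3) by (fastforce simp: Ban_simps compose_def)
qed

theorem proposition2p8:
  shows "contravariant_functor
    (Ban :: ('v::zfc_model normed_space, 'v \<Rightarrow> 'v) cat) Ban Inv Inv_map"
proof (intro contravariant_functor.intro contravariant_functor_axioms.intro category_Ban)
  fix X :: "'v normed_space" assume X: "X \<in> Obj Ban"
  then interpret X: small_normed_space X by (simp add: Obj_Ban_iff)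
  show "Inv X \<in> Obj Ban"
    using X.banach_space_Inv X.small_Inv by (simp add: Ban_def)
  show "Inv_map X X (Id Ban X) = Id Ban (Inv X)"
    by (simp add: Ban_simps Inv_map_id X.small_normed_space_axioms)
next
  fix X Y :: "'v normed_space" and f
  assume "X \<in> Obj Ban" "Y \<in> Obj Ban" "f \<in> Hom Ban X Y"
  then have "bounded_op X Y f"
    by (simp add: bounded_op_iff_Hom)
  then show "Inv_map X Y f \<in> Hom Ban (Inv Y) (Inv X)"
    by (simp add: Ban_simps bounded_op.Inv_map_bounded_ops)
next
  fix X Y Z :: "'v normed_space" and f g
  assume "X \<in> Obj Ban" "Y \<in> Obj Ban" "Z \<in> Obj Ban" "f \<in> Hom Ban X Y" "g \<in> Hom Ban Y Z"
  then have "bounded_op X Y f" "bounded_op Y Z g"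
    by (simp_all add: bounded_op_iff_Hom)
  then show "Inv_map X Z (Comp Ban X Y Z g f) =
      Comp Ban (Inv Z) (Inv Y) (Inv X) (Inv_map X Y f) (Inv_map Y Z g)"
    by (simp add: Ban_simps Inv_map_compose)
qed

end
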